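(* For all $\varepsilon',d>0$ there exist $\varepsilon,c>0$ such that for all $0<p<1$ the following holds. Let $G\subseteq\Gamma$ be graphs and let $X,Y,Z$ be (pairwise) disjoint vertex sets in $V(\Gamma)$. Assume that (1) $(X,Y)$ is $\big(p,\,c\,p^{3/2}\sqrt{|X||Y|}\big)$-bijumbled in $\Gamma$, (2) $(Y,Z)$ is $\big(p,\,c\,p^{2}(\log_2\tfrac1p)^{-1/2}\sqrt{|Y||Z|}\big)$-bijumbled in $\Gamma$, and (3) $(Y,Z)$ is $(\varepsilon,d,p)$-regular in $G$. Then, for all but at most $\varepsilon'|X|$ vertices $x$ of $X$, the pair $\big(N_\Gamma(x)\cap Y,\,Z\big)$ is $(\varepsilon',d,p)$-regular in $G$.
   Context: Graphs are finite and simple. $N_\Gamma(x)$ is the neighbourhood of $x$ in $\Gamma$. For disjoint vertex sets $U,W$ in a graph, $e(U,W)$ is the number of edges between $U$ and $W$. Bijumbled: a pair $(U,V)$ of disjoint vertex sets of $\Gamma$ is $(p,\gamma)$-bijumbled in $\Gamma$ if for all $U'\subseteq U$ and $V'\subseteq V$ we have $\big|e_\Gamma(U',V')-p|U'||V'|\big|\le\gamma\sqrt{|U'||V'|}$. Sparse regularity: for $p>0$, the $p$-density of a pair $(U,W)$ of disjoint nonempty vertex sets in a graph $G$ is $d_p(U,W)=e_G(U,W)/(p|U||W|)$. The pair $(U,W)$ is $(\varepsilon,p)$-regular in $G$ if $|d_p(U',W')-d_p(U,W)|\le\varepsilon$ for all $U'\subseteq U$, $W'\subseteq W$ with $|U'|\ge\varepsilon|U|$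 and $|W'|\ge\varepsilon|W|$. It is $(\varepsilon,d,p)$-regular in $G$ if moreover $d_p(U,W)\ge d-\varepsilon$. *)

theory Defs
  imports Complex_Main
begin

record 'a sgraph =
  verts :: "'a set"
  edges :: "'a set set"

definition simple_graph :: "'a sgraph \<Rightarrow> bool" where
  "simple_graph G \<longleftrightarrow> finite (verts G) \<and> (\<forall>e\<in>edges G. e \<subseteq> verts G \<and> card e = 2)"

definition is_subgraph :: "'a sgraph \<Rightarrow> 'a sgraph \<Rightarrow> bool" where
  "is_subgraph G H \<longleftrightarrow> verts G \<subseteq> verts H \<and> edges G \<subseteq> edges H"

definition neighbourhood :: "'a sgraph \<Rightarrow> 'a \<Rightarrow> 'a set" where
  "neighbourhood G x = {y. {x, y} \<in> edges G}"

definition num_edges :: "'a sgraph \<Rightarrow> 'a set \<Rightarrow> 'a set \<Rightarrow> nat" where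
  "num_edges G U W = card {e \<in> edges G. \<exists>u\<in>U. \<exists>w\<in>W. e = {u, w}}"

definition vertex_pair :: "'a sgraph \<Rightarrow> 'a set \<Rightarrow> 'a set \<Rightarrow> bool" where
  "vertex_pair G U W \<longleftrightarrow> U \<subseteq> verts G \<and> W \<subseteq> verts G \<and> U \<inter> W = {}"

definition bijumbled :: "real \<Rightarrow> real \<Rightarrow> 'a sgraph \<Rightarrow> 'a set \<Rightarrow> 'a set \<Rightarrow> bool" where
  "bijumbled p \<gamma> G U V \<longleftrightarrow> vertex_pair G U V \<and>
     (\<forall>U' V'. U' \<subseteq> U \<longrightarrow> V' \<subseteq> V \<longrightarrow>
        \<bar>real (num_edges G U' V') - p * real (card U') * real (card V')\<bar>
          \<le> \<gamma> * sqrt (real (card U') * real (card V')))"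

definition p_density :: "real \<Rightarrow> 'a sgraph \<Rightarrow> 'a set \<Rightarrow> 'a set \<Rightarrow> real" where
  "p_density p G U W = real (num_edges G U W) / (p * real (card U) * real (card W))"

text \<open>The \<^term>\<open>p\<close>-density is a meaningful quotient only for nonempty sets, so nonemptiness of
  \<^term>\<open>U\<close> and \<^term>\<open>W\<close> is part of regularity. For \<^prop>\<open>\<epsilon> > 0\<close> the size conditions then force
  \<^term>\<open>U'\<close> and \<^term>\<open>W'\<close> to be nonempty as well.\<close>

definition sparse_regular :: "real \<Rightarrow> real \<Rightarrow> 'a sgraph \<Rightarrow> 'a set \<Rightarrow> 'a set \<Rightarrow> bool" where
  "sparse_regular \<epsilon> p G U W \<longleftrightarrow> vertex_pair G U W \<and> U \<noteq> {} \<and> W \<noteq> {} \<and>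
     (\<forall>U' W'. U' \<subseteq> U \<longrightarrow> W' \<subseteq> W \<longrightarrow>
        real (card U') \<ge> \<epsilon> * real (card U) \<longrightarrow> real (card W') \<ge> \<epsilon> * real (card W) \<longrightarrow>
        \<bar>p_density p G U' W' - p_density p G U W\<bar> \<le> \<epsilon>)"

definition sparse_regular_dense ::
    "real \<Rightarrow> real \<Rightarrow> real \<Rightarrow> 'a sgraph \<Rightarrow> 'a set \<Rightarrow> 'a set \<Rightarrow> bool" where
  "sparse_regular_dense \<epsilon> d p G U W \<longleftrightarrow>
     sparse_regular \<epsilon> p G U W \<and> p_density p G U W \<ge> d - \<epsilon>"

end

theory Submission
  imports Defs "HOL-Analysis.Convex"
begin

text \<open>
  Write \<open>L\<close>, \<open>M\<close>, \<open>N\<close> for the sizes of \<open>X\<close>, \<open>Y\<close>, \<open>Z\<close>, let \<open>q\<close> be the edge density of \<open>(Y, Z)\<close> in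
  \<open>G\<close>, and let \<open>g = G - q\<close> be the balanced function on \<open>Y \<times> Z\<close>. A neighbourhood \<open>A\<close> of a vertex of \<open>X\<close>
  has about \<open>p M\<close> elements, for small \<open>p\<close> far below the size at which regularity of \<open>(Y, Z)\<close> says anything
  directly. The route to \<open>(A, Z)\<close> goes through the codegree deviation
  \<open>K(y, y') = (\<Sum>z. g(y,z) g(y',z))\<close>: by Cauchy-Schwarz, the discrepancy of \<open>S \<subseteq> A\<close> against \<open>T \<subseteq> Z\<close>
  is at most the square root of \<open>N (\<Sum>y,y'\<in>A. \<bar>K(y,y')\<bar>)\<close>, so \<open>(A, Z)\<close> is regular as soon as this sum
  is small compared with \<open>p^4 M^2 N\<close>.

  First, \<open>\<bar>K\<bar>\<close> is small on average over all pairs of \<open>Y\<close>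
  (\<open>sum_abs_codegree_deviation_le\<close>). With signs \<open>s\<close> chosen to remove the absolute values, the sum
  is \<open>\<Sum>y,z. g(y,z) F(y,z)\<close> where \<open>F(y,z) = (\<Sum>y'. s(y,y') g(y',z))\<close>. Each row of \<open>F\<close> is a signed
  combination of degrees over a large set, hence small in mean by regularity. The sum is dominated
  by \<open>\<Sum>y,z. \<Gamma>(y,z) \<bar>F(y,z)\<bar>\<close>, and after passing to \<open>F\<^sup>2\<close> the sparse weight \<open>\<Gamma>\<close> may be replaced by the
  constant \<open>p\<close>: for each fixed pair \<open>y', y''\<close> the replacement error is a bilinear form in
  \<open>\<Gamma> - p\<close> evaluated at a sign vector on \<open>Y\<close> and at a vector on \<open>Z\<close> supported essentially on a
  common neighbourhood, of size about \<open>p\<^sup>2 N\<close>. This is the place where jumbledness \<open>c p\<^sup>2 sqrt(M N)\<close> of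
  \<open>(Y, Z)\<close> is what the estimate asks for.

  Second, summing \<open>\<Sum>y,y'\<in>A. \<bar>K(y,y')\<bar>\<close> over all neighbourhoods \<open>A\<close> weights a pair by its codegree
  into \<open>X\<close>. Jumbledness of order \<open>p^(3/2)\<close> on \<open>(X, Y)\<close> makes this codegree at most \<open>4 p\<^sup>2 L\<close>
  outside few pairs, and the contribution of the exceptional pairs, as well as that of pairs with large codegree
  into \<open>Z\<close>, is negligible (\<open>sum_codegree_weight_le\<close>). Markov's inequality then shows that all
  but a small fraction of the neighbourhoods have a small sum
  (\<open>most_neighbourhoods_have_small_discrepancy\<close>).

  Vertices of atypically large degree are few and are cut off beforehand. For \<open>p \<le> 1/2\<close> the factor
  \<open>(log 2 (1/p)) powr (-1/2)\<close> is at most \<open>1\<close>, which gives the jumbledness used above. For \<open>p > 1/2\<close> a typical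
  neighbourhood contains a quarter of \<open>Y\<close>, and regularity passes to it directly.
\<close>

section \<open>Jumbled bipartite weights\<close>

text \<open>Graphs enter the argument only through their adjacency functions, so jumbledness is stated
  for real weights on pairs; subsets and transposes then need no translation.\<close>

definition jumbled :: "real \<Rightarrow> real \<Rightarrow> ('u \<Rightarrow> 'v \<Rightarrow> real) \<Rightarrow> 'u set \<Rightarrow> 'v set \<Rightarrow> bool" where
  "jumbled p \<gamma> b U V \<longleftrightarrow> (\<forall>S T. S \<subseteq> U \<longrightarrow> T \<subseteq> V \<longrightarrow>
     \<bar>\<Sum>u\<in>S. \<Sum>v\<in>T. (b u v - p)\<bar> \<le> \<gamma> * sqrt (real (card S) * real (card T)))"

lemma jumbledD:
  "jumbled p \<gamma> b U V \<Longrightarrow> S \<subseteq> U \<Longrightarrow> T \<subseteq> V \<Longrightarrow>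
    \<bar>\<Sum>u\<in>S. \<Sum>v\<in>T. (b u v - p)\<bar> \<le> \<gamma> * sqrt (real (card S) * real (card T))"
  unfolding jumbled_def by blast

lemma jumbled_subset:
  "jumbled p \<gamma> b U V \<Longrightarrow> S \<subseteq> U \<Longrightarrow> T \<subseteq> V \<Longrightarrow> jumbled p \<gamma> b S T"
  unfolding jumbled_def by (meson subset_trans)

lemma jumbled_transpose:
  assumes "jumbled p \<gamma> b U V"
  shows "jumbled p \<gamma> (\<lambda>v u. b u v) V U"
  unfolding jumbled_def
proof (intro allI impI)
  fix S T assume "S \<subseteq> V" "T \<subseteq> U"
  then show "\<bar>\<Sum>u\<in>S. \<Sum>v\<in>T. (b v u - p)\<bar> \<le> \<gamma> * sqrt (real (card S) * real (card T))"
    using jumbledD[OF assms, of T S] sum.swap[of "\<lambda>u v. b u v - p" S T]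
    by (simp add: mult.commute)
qed

lemma jumbled_upper:
  assumes "jumbled p \<gamma> b U V" "S \<subseteq> U" "T \<subseteq> V"
  shows "(\<Sum>u\<in>S. \<Sum>v\<in>T. b u v)
    \<le> p * real (card S) * real (card T) + \<gamma> * sqrt (real (card S) * real (card T))"
proof -
  have "(\<Sum>u\<in>S. \<Sum>v\<in>T. (b u v - p)) = (\<Sum>u\<in>S. \<Sum>v\<in>T. b u v) - p * real (card S) * real (card T)"
    by (simp add: sum_subtractf)
  then show ?thesis using jumbledD[OF assms] by linarith
qed

text \<open>The form in which jumbledness bounds the size \<open>s\<close> of an exceptional set: its discrepancy is
  linear in \<open>s\<close> from below and of order \<open>sqrt s\<close> from above.\<close>

lemma le_if_mult_le_sqrt:
  fixes t s g v :: real
  assumes "t > 0" "s \<ge> 0" "v \<ge> 0" and le: "t * s \<le> g * sqrt (v * s)"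
  shows "t\<^sup>2 * s \<le> g\<^sup>2 * v"
proof (cases "s = 0")
  case False
  then have s: "s > 0" using assms by simp
  have "(t * s)\<^sup>2 \<le> (g * sqrt (v * s))\<^sup>2"
    using le assms by (intro power_mono) auto
  then have "(t\<^sup>2 * s) * s \<le> (g\<^sup>2 * v) * s"
    using assms by (simp add: power_mult_distrib power2_eq_square mult_ac)
  then show ?thesis using s by simp
qed (use assms in auto)

text \<open>The vertices of \<open>T\<close> deviate from the expected degree in the same direction, so their deviations
  add up in the discrepancy of \<open>(S, T)\<close>, which grows only like the square root of \<open>card T\<close>.\<close>

lemma jumbled_few_exceptional:
  assumes j: "jumbled p \<gamma> b U V" and S: "S \<subseteq> U" and T: "T \<subseteq> V" "finite T" and t: "t > 0"
    and dev: "(\<forall>v\<in>T. (\<Sum>u\<in>S. b u v) \<ge> p * real (card S) + t) \<or>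
              (\<forall>v\<in>T. (\<Sum>u\<in>S. b u v) \<le> p * real (card S) - t)"
  shows "t\<^sup>2 * real (card T) \<le> \<gamma>\<^sup>2 * real (card S)"
proof -
  have eq: "(\<Sum>u\<in>S. \<Sum>v\<in>T. (b u v - p)) = (\<Sum>v\<in>T. (\<Sum>u\<in>S. b u v) - p * real (card S))"
    by (subst sum.swap) (simp add: sum_subtractf mult.commute)
  have "t * real (card T) \<le> \<bar>\<Sum>v\<in>T. (\<Sum>u\<in>S. b u v) - p * real (card S)\<bar>"
    using dev
  proof
    assume "\<forall>v\<in>T. (\<Sum>u\<in>S. b u v) \<ge> p * real (card S) + t"
    then have "(\<Sum>v\<in>T. t) \<le> (\<Sum>v\<in>T. (\<Sum>u\<in>S. b u v) - p * real (card S))"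
      by (intro sum_mono) fastforce
    then show ?thesis by (simp add: mult.commute)
  next
    assume "\<forall>v\<in>T. (\<Sum>u\<in>S. b u v) \<le> p * real (card S) - t"
    then have "(\<Sum>v\<in>T. (\<Sum>u\<in>S. b u v) - p * real (card S)) \<le> (\<Sum>v\<in>T. - t)"
      by (intro sum_mono) fastforce
    then show ?thesis by (simp add: mult.commute)
  qed
  then have "t * real (card T) \<le> \<gamma> * sqrt (real (card S) * real (card T))"
    using jumbledD[OF j S T(1)] eq by linarith
  then show ?thesis using le_if_mult_le_sqrt t by simp
qed

text \<open>A cut bound for all subsets of rows costs only a factor 2 when the rows carry signs: split them
  into the positive and the negative ones.\<close>

lemma abs_sum_signed_le:
  fixes f :: "'u \<Rightarrow> 'v \<Rightarrow> real"
  assumes Y: "finite Y" and s: "\<And>y. y \<in> Y \<Longrightarrow> s y = 1 \<or> s y = -1"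
    and bound: "\<And>S. S \<subseteq> Y \<Longrightarrow> \<bar>\<Sum>y\<in>S. \<Sum>z\<in>T. f y z\<bar> \<le> B"
  shows "\<bar>\<Sum>y\<in>Y. \<Sum>z\<in>T. s y * f y z\<bar> \<le> 2 * B"
proof -
  define P where "P = {y\<in>Y. s y = 1}"
  define Q where "Q = {y\<in>Y. s y \<noteq> 1}"
  have Yeq: "Y = P \<union> Q" "P \<inter> Q = {}" "finite P" "finite Q" unfolding P_def Q_def using Y by auto
  have "(\<Sum>y\<in>Y. \<Sum>z\<in>T. s y * f y z) = (\<Sum>y\<in>P. \<Sum>z\<in>T. s y * f y z) + (\<Sum>y\<in>Q. \<Sum>z\<in>T. s y * f y z)"
    using Yeq by (simp add: sum.union_disjoint)
  also have "(\<Sum>y\<in>P. \<Sum>z\<in>T. s y * f y z) = (\<Sum>y\<in>P. \<Sum>z\<in>T. f y z)"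
    by (intro sum.cong) (auto simp: P_def)
  also have "(\<Sum>y\<in>Q. \<Sum>z\<in>T. s y * f y z) = (\<Sum>y\<in>Q. - (\<Sum>z\<in>T. f y z))"
    unfolding sum_negf[symmetric] using s by (intro sum.cong) (fastforce simp: Q_def)+
  finally show ?thesis
    using bound[of P] bound[of Q] Yeq by (auto simp: sum_negf)
qed

lemma sum_abs_split:
  fixes f :: "'v \<Rightarrow> real"
  assumes Z: "finite Z" and bound: "\<And>T. T \<subseteq> Z \<Longrightarrow> \<bar>\<Sum>z\<in>T. f z\<bar> \<le> B"
  shows "(\<Sum>z\<in>Z. \<bar>f z\<bar>) \<le> 2 * B"
proof -
  define P where "P = {z\<in>Z. f z \<ge> 0}"
  define Q where "Q = {z\<in>Z. f z < 0}"
  have Zeq: "Z = P \<union> Q" "P \<inter> Q = {}" "finite P" "finite Q" unfolding P_def Q_def using Z by auto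
  have "(\<Sum>z\<in>Z. \<bar>f z\<bar>) = (\<Sum>z\<in>P. \<bar>f z\<bar>) + (\<Sum>z\<in>Q. \<bar>f z\<bar>)"
    using Zeq by (simp add: sum.union_disjoint)
  also have "(\<Sum>z\<in>P. \<bar>f z\<bar>) = (\<Sum>z\<in>P. f z)"
    by (intro sum.cong) (auto simp: P_def)
  also have "(\<Sum>z\<in>Q. \<bar>f z\<bar>) = - (\<Sum>z\<in>Q. f z)"
    unfolding sum_negf[symmetric] by (intro sum.cong) (auto simp: Q_def)
  finally show ?thesis
    using bound[of P] bound[of Q] Zeq by (auto simp: sum_negf)
qed

lemma sum_zero_one_mult:
  fixes f t :: "'u \<Rightarrow> real"
  assumes "finite X" "\<And>x. x \<in> X \<Longrightarrow> f x = 0 \<or> f x = 1"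
  shows "(\<Sum>x\<in>X. f x * t x) = (\<Sum>x\<in>{x\<in>X. f x = 1}. t x)"
  unfolding sum.inter_filter[OF assms(1)] using assms(2) by (intro sum.cong) fastforce+

lemma sum_zero_one:
  fixes f :: "'u \<Rightarrow> real"
  assumes "finite X" "\<And>x. x \<in> X \<Longrightarrow> f x = 0 \<or> f x = 1"
  shows "(\<Sum>x\<in>X. f x) = real (card {x\<in>X. f x = 1})"
  using sum_zero_one_mult[of X f "\<lambda>_. 1"] assms by simp

lemma sqrt_le_AM_GM:
  assumes "x \<ge> 0" "a > 0"
  shows "sqrt x \<le> x / (2 * a) + a / 2"
proof -
  have "sqrt x * (2 * a) \<le> x + a\<^sup>2"
    using sum_squares_bound[of "sqrt x" a] assms by (simp add: mult_ac)
  then show ?thesis using assms by (simp add: field_simps power2_eq_square)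
qed

lemma markov_card:
  fixes f :: "'u \<Rightarrow> real"
  assumes "finite X" "t > 0" "\<And>x. x \<in> X \<Longrightarrow> f x \<ge> 0"
  shows "t * real (card {x\<in>X. f x > t}) \<le> sum f X"
proof -
  have "t * real (card {x\<in>X. f x > t}) = (\<Sum>x\<in>{x\<in>X. f x > t}. t)" by simp
  also have "\<dots> \<le> (\<Sum>x\<in>{x\<in>X. f x > t}. f x)" by (intro sum_mono) auto
  also have "\<dots> \<le> sum f X" using assms by (intro sum_mono2) auto
  finally show ?thesis .
qed

section \<open>Codegree deviations are small on average\<close>

text \<open>Jumbledness as a bound on the bilinear form of \<open>b - p\<close> at a sign vector and an indicator vector.\<close>

lemma jumbled_bilinear_le:
  fixes b :: "'u \<Rightarrow> 'v \<Rightarrow> real"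
  assumes j: "jumbled p \<gamma> b Y Z" and fin: "finite Y" "finite Z" and \<gamma>: "\<gamma> \<ge> 0"
    and s: "\<And>y. y \<in> Y \<Longrightarrow> s y = 1 \<or> s y = -1"
    and k: "\<And>z. z \<in> Z \<Longrightarrow> k z = 0 \<or> k z = 1"
  shows "\<bar>\<Sum>z\<in>Z. (\<Sum>y\<in>Y. s y * (b y z - p)) * k z\<bar>
    \<le> 2 * (\<gamma> * sqrt (real (card Y)) * sqrt (\<Sum>z\<in>Z. k z))"
proof -
  define V where "V = {z\<in>Z. k z = 1}"
  have V: "V \<subseteq> Z" by (auto simp: V_def)
  have cardV: "(\<Sum>z\<in>Z. k z) = real (card V)"
    unfolding V_def by (rule sum_zero_one[OF fin(2) k])
  have "(\<Sum>z\<in>Z. (\<Sum>y\<in>Y. s y * (b y z - p)) * k z) = (\<Sum>z\<in>V. \<Sum>y\<in>Y. s y * (b y z - p))"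
    unfolding V_def mult.commute[of _ "k _"] by (rule sum_zero_one_mult[OF fin(2) k])
  also have "\<dots> = (\<Sum>y\<in>Y. \<Sum>z\<in>V. s y * (b y z - p))" by (rule sum.swap)
  finally have eq: "(\<Sum>z\<in>Z. (\<Sum>y\<in>Y. s y * (b y z - p)) * k z) = (\<Sum>y\<in>Y. \<Sum>z\<in>V. s y * (b y z - p))" .
  have "\<bar>\<Sum>y\<in>Y. \<Sum>z\<in>V. s y * (b y z - p)\<bar> \<le> 2 * (\<gamma> * sqrt (real (card Y)) * sqrt (real (card V)))"
  proof (rule abs_sum_signed_le[OF fin(1) s])
    fix S assume S: "S \<subseteq> Y"
    have "\<bar>\<Sum>y\<in>S. \<Sum>z\<in>V. (b y z - p)\<bar> \<le> \<gamma> * sqrt (real (card S) * real (card V))"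
      by (rule jumbledD[OF j S V])
    also have "\<dots> \<le> \<gamma> * sqrt (real (card Y) * real (card V))"
      using card_mono[OF fin(1) S] \<gamma> by (intro mult_left_mono real_sqrt_le_mono mult_right_mono) auto
    finally show "\<bar>\<Sum>y\<in>S. \<Sum>z\<in>V. (b y z - p)\<bar> \<le> \<gamma> * sqrt (real (card Y)) * sqrt (real (card V))"
      by (simp add: real_sqrt_mult)
  qed
  then show ?thesis unfolding eq cardV .
qed

text \<open>The weight \<open>(h - q) (h' - q)\<close> is a combination of four indicators. The bound is governed by the
  support sizes of these rather than by the sup norm of the weight; for two neighbourhoods \<open>h\<close>, \<open>h'\<close> of
  density about \<open>p\<close>, and \<open>q\<close> of order \<open>p\<close>, every term is at most of order \<open>p sqrt (card Z)\<close>.\<close>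

lemma jumbled_product_weight_le:
  fixes b :: "'u \<Rightarrow> 'v \<Rightarrow> real"
  assumes j: "jumbled p \<gamma> b Y Z" and fin: "finite Y" "finite Z" and \<gamma>: "\<gamma> \<ge> 0" and q: "q \<ge> 0"
    and s: "\<And>y. y \<in> Y \<Longrightarrow> s y = 1 \<or> s y = -1"
    and h: "\<And>z. z \<in> Z \<Longrightarrow> h z = 0 \<or> h z = 1" and h': "\<And>z. z \<in> Z \<Longrightarrow> h' z = 0 \<or> h' z = 1"
  shows "\<bar>\<Sum>z\<in>Z. (\<Sum>y\<in>Y. s y * (b y z - p)) * ((h z - q) * (h' z - q))\<bar>
    \<le> 2 * \<gamma> * sqrt (real (card Y)) *
       (sqrt (\<Sum>z\<in>Z. h z * h' z) + q * sqrt (\<Sum>z\<in>Z. h z) + q * sqrt (\<Sum>z\<in>Z. h' z)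
         + q\<^sup>2 * sqrt (real (card Z)))"
proof -
  define r where "r z = (\<Sum>y\<in>Y. s y * (b y z - p))" for z
  define C where "C = 2 * \<gamma> * sqrt (real (card Y))"
  have base: "\<bar>\<Sum>z\<in>Z. r z * k z\<bar> \<le> C * sqrt (\<Sum>z\<in>Z. k z)"
    if "\<And>z. z \<in> Z \<Longrightarrow> k z = 0 \<or> k z = 1" for k
    using jumbled_bilinear_le[OF j fin \<gamma>, of s k] s that unfolding r_def C_def by (simp add: mult_ac)
  have b1: "\<bar>\<Sum>z\<in>Z. r z * (h z * h' z)\<bar> \<le> C * sqrt (\<Sum>z\<in>Z. h z * h' z)"
    using h h' by (intro base) fastforce
  have b2: "q * \<bar>\<Sum>z\<in>Z. r z * h z\<bar> \<le> q * (C * sqrt (\<Sum>z\<in>Z. h z))"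
    using h q by (intro mult_left_mono base) auto
  have b3: "q * \<bar>\<Sum>z\<in>Z. r z * h' z\<bar> \<le> q * (C * sqrt (\<Sum>z\<in>Z. h' z))"
    using h' q by (intro mult_left_mono base) auto
  have b4: "q\<^sup>2 * \<bar>\<Sum>z\<in>Z. r z * 1\<bar> \<le> q\<^sup>2 * (C * sqrt (\<Sum>z\<in>Z. 1))"
    using q by (intro mult_left_mono base) auto
  have eq: "(\<Sum>z\<in>Z. r z * ((h z - q) * (h' z - q))) =
      (\<Sum>z\<in>Z. r z * (h z * h' z)) - q * (\<Sum>z\<in>Z. r z * h z) - q * (\<Sum>z\<in>Z. r z * h' z) + q\<^sup>2 * (\<Sum>z\<in>Z. r z * 1)"
    unfolding sum_distrib_left sum_subtractf[symmetric] sum.distrib[symmetric]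
    by (intro sum.cong) (auto simp: algebra_simps power2_eq_square)
  have "\<bar>\<Sum>z\<in>Z. r z * ((h z - q) * (h' z - q))\<bar> \<le>
      \<bar>\<Sum>z\<in>Z. r z * (h z * h' z)\<bar> + \<bar>q * (\<Sum>z\<in>Z. r z * h z)\<bar> + \<bar>q * (\<Sum>z\<in>Z. r z * h' z)\<bar> + \<bar>q\<^sup>2 * (\<Sum>z\<in>Z. r z * 1)\<bar>"
    unfolding eq by linarith
  also have "\<dots> = \<bar>\<Sum>z\<in>Z. r z * (h z * h' z)\<bar> + q * \<bar>\<Sum>z\<in>Z. r z * h z\<bar> + q * \<bar>\<Sum>z\<in>Z. r z * h' z\<bar> + q\<^sup>2 * \<bar>\<Sum>z\<in>Z. r z * 1\<bar>"
    using q by (simp add: abs_mult)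
  also have "\<dots> \<le> C * (sqrt (\<Sum>z\<in>Z. h z * h' z) + q * sqrt (\<Sum>z\<in>Z. h z) + q * sqrt (\<Sum>z\<in>Z. h' z)
         + q\<^sup>2 * sqrt (real (card Z)))"
    using b1 b2 b3 b4 by (simp add: algebra_simps)
  finally show ?thesis unfolding r_def C_def .
qed

text \<open>Here \<open>b\<close> is the ambient jumbled graph and \<open>h\<close> the regular subgraph, regularity entering as the cut
  bound with \<open>\<eta>\<close>. The condition relating \<open>\<mu>\<close> to \<open>\<eta>\<close> and \<open>c\<close> is what the two error sources amount
  to: \<open>16 \<eta>\<close> comes from the mean of \<open>\<bar>F\<bar>\<close> and \<open>25 c\<close> from exchanging \<open>b\<close> for \<open>p\<close> in the sum of
  \<open>b F\<^sup>2\<close>. The square root lost between \<open>\<mu>\<^sup>2\<close> and \<open>\<mu>\<close> is due to passing from \<open>\<bar>F\<bar>\<close> to \<open>F\<^sup>2\<close>.\<close>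

lemma sum_abs_codegree_deviation_le:
  fixes b h :: "'u \<Rightarrow> 'v \<Rightarrow> real"
  assumes fin: "finite Y" "finite Z"
    and card: "real (card Y) \<le> M" "real (card Z) \<le> N" and MN: "M > 0" "N > 0"
    and p: "0 < p" "p \<le> 1" and q: "0 \<le> q" "q \<le> 2 * p" and c: "c \<ge> 0"
    and \<mu>: "0 < \<mu>" "\<mu> \<le> 1" "16 * \<eta> + 25 * c \<le> \<mu>\<^sup>2"
    and b: "\<And>y z. b y z = 0 \<or> b y z = 1" and h: "\<And>y z. h y z = 0 \<or> h y z = 1"
    and hb: "\<And>y z. h y z \<le> b y z"
    and degY: "\<And>y. y \<in> Y \<Longrightarrow> (\<Sum>z\<in>Z. b y z) \<le> 2 * p * N"
    and degZ: "\<And>z. z \<in> Z \<Longrightarrow> (\<Sum>y\<in>Y. b y z) \<le> 2 * p * M"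
    and j: "jumbled p (c * p\<^sup>2 * sqrt (M * N)) b Y Z"
    and cut: "\<And>S T. S \<subseteq> Y \<Longrightarrow> T \<subseteq> Z \<Longrightarrow> \<bar>\<Sum>y\<in>S. \<Sum>z\<in>T. (h y z - q)\<bar> \<le> \<eta> * p * M * N"
  shows "(\<Sum>y\<in>Y. \<Sum>y'\<in>Y. \<bar>\<Sum>z\<in>Z. (h y z - q) * (h y' z - q)\<bar>) \<le> 3 * \<mu> * p\<^sup>2 * M\<^sup>2 * N"
proof -
  define g where "g y z = h y z - q" for y z
  define K where "K y y' = (\<Sum>z\<in>Z. g y z * g y' z)" for y y'
  define s where "s y y' = (if K y y' \<ge> 0 then 1 else -1 :: real)" for y y'
  define F where "F y z = (\<Sum>y'\<in>Y. s y y' * g y' z)" for y z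
  have b01: "0 \<le> b y z" "b y z \<le> 1" for y z using b[of y z] by auto
  have h01: "0 \<le> h y z" "h y z \<le> 1" for y z using h[of y z] by auto
  have s1: "s y y' = 1 \<or> s y y' = -1" for y y' by (simp add: s_def)
  have s_abs: "\<bar>s y y'\<bar> = 1" for y y' by (simp add: s_def)
  have g_abs: "\<bar>g y z\<bar> \<le> b y z + 2 * p" for y z
    using hb[of y z] h01[of y z] q unfolding g_def by linarith
  have \<eta>: "0 \<le> \<eta>"
  proof -
    have "0 \<le> \<eta> * (p * M * N)" using cut[of "{}" "{}"] by (simp add: mult.assoc)
    moreover have "0 < p * M * N" using p MN by simp
    ultimately show ?thesis by (simp add: zero_le_mult_iff)
  qed

  \<comment> \<open>Regularity: for fixed \<open>y\<close>, the function \<open>F y\<close> is a signed sum of rows of \<open>g\<close> over all of \<open>Y\<close>.\<close>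
  have F_sum: "(\<Sum>z\<in>Z. \<bar>F y z\<bar>) \<le> 4 * \<eta> * p * M * N" for y
  proof -
    have "\<bar>\<Sum>z\<in>T. F y z\<bar> \<le> 2 * (\<eta> * p * M * N)" if T: "T \<subseteq> Z" for T
    proof -
      have "(\<Sum>z\<in>T. F y z) = (\<Sum>y'\<in>Y. \<Sum>z\<in>T. s y y' * g y' z)"
        unfolding F_def by (rule sum.swap)
      moreover have "\<bar>\<Sum>y'\<in>Y. \<Sum>z\<in>T. s y y' * g y' z\<bar> \<le> 2 * (\<eta> * p * M * N)"
        using cut[OF _ T] s1 fin(1) unfolding g_def by (intro abs_sum_signed_le) auto
      ultimately show ?thesis by simp
    qed
    from sum_abs_split[OF fin(2) this] show ?thesis by simp
  qed
  have F_max: "\<bar>F y z\<bar> \<le> 4 * p * M" if "z \<in> Z" for y z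
  proof -
    have "\<bar>F y z\<bar> \<le> (\<Sum>y'\<in>Y. \<bar>s y y' * g y' z\<bar>)" unfolding F_def by (rule sum_abs)
    also have "\<dots> \<le> (\<Sum>y'\<in>Y. b y' z + 2 * p)"
      using g_abs by (intro sum_mono) (simp add: abs_mult s_abs)
    also have "\<dots> = (\<Sum>y'\<in>Y. b y' z) + 2 * p * real (card Y)" by (simp add: sum.distrib)
    also have "\<dots> \<le> 2 * p * M + 2 * p * M"
      using degZ[OF that] card p by (intro add_mono mult_left_mono) auto
    finally show ?thesis by (simp add: mult_ac)
  qed
  have F_all: "(\<Sum>y\<in>Y. \<Sum>z\<in>Z. \<bar>F y z\<bar>) \<le> M * (4 * \<eta> * p * M * N)"
  proof -
    have "(\<Sum>y\<in>Y. \<Sum>z\<in>Z. \<bar>F y z\<bar>) \<le> real (card Y) * (4 * \<eta> * p * M * N)"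
      using F_sum by (intro sum_bounded_above) auto
    also have "\<dots> \<le> M * (4 * \<eta> * p * M * N)"
      using card \<eta> p MN by (intro mult_right_mono) auto
    finally show ?thesis .
  qed
  have F_sq: "(\<Sum>y\<in>Y. \<Sum>z\<in>Z. (F y z)\<^sup>2) \<le> 16 * \<eta> * p\<^sup>2 * M^3 * N"
  proof -
    have "(\<Sum>y\<in>Y. \<Sum>z\<in>Z. (F y z)\<^sup>2) \<le> (\<Sum>y\<in>Y. \<Sum>z\<in>Z. 4 * p * M * \<bar>F y z\<bar>)"
    proof (intro sum_mono)
      fix y z assume "z \<in> Z"
      then have "\<bar>F y z\<bar> * \<bar>F y z\<bar> \<le> 4 * p * M * \<bar>F y z\<bar>" by (intro mult_right_mono F_max) auto
      then show "(F y z)\<^sup>2 \<le> 4 * p * M * \<bar>F y z\<bar>" by (simp add: power2_eq_square)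
    qed
    also have "\<dots> = 4 * p * M * (\<Sum>y\<in>Y. \<Sum>z\<in>Z. \<bar>F y z\<bar>)" by (simp add: sum_distrib_left)
    also have "\<dots> \<le> 4 * p * M * (M * (4 * \<eta> * p * M * N))"
      using F_all p MN by (intro mult_left_mono) auto
    finally show ?thesis by (simp add: power2_eq_square power3_eq_cube mult_ac)
  qed
  have b_all: "(\<Sum>y\<in>Y. \<Sum>z\<in>Z. b y z) \<le> 2 * p * M * N"
  proof -
    have "(\<Sum>y\<in>Y. \<Sum>z\<in>Z. b y z) \<le> real (card Y) * (2 * p * N)"
      using degY by (intro sum_bounded_above) auto
    also have "\<dots> \<le> M * (2 * p * N)" using card p MN by (intro mult_right_mono) auto
    finally show ?thesis by (simp add: mult_ac)
  qed

  \<comment> \<open>For fixed \<open>y1\<close>, \<open>y2\<close> the products of signs form a sign vector in \<open>y\<close>, so jumbledness applies.\<close>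
  have pair: "\<bar>\<Sum>z\<in>Z. (\<Sum>y\<in>Y. (s y y1 * s y y2) * (b y z - p)) * (g y1 z * g y2 z)\<bar>
      \<le> 2 * c * p\<^sup>2 * M * sqrt N * (sqrt (\<Sum>z\<in>Z. b y1 z * b y2 z) + 10 * p * sqrt N)"
    if y: "y1 \<in> Y" "y2 \<in> Y" for y1 y2
  proof -
    have "\<bar>\<Sum>z\<in>Z. (\<Sum>y\<in>Y. (s y y1 * s y y2) * (b y z - p)) * (g y1 z * g y2 z)\<bar>
      \<le> 2 * (c * p\<^sup>2 * sqrt (M * N)) * sqrt (real (card Y)) *
       (sqrt (\<Sum>z\<in>Z. h y1 z * h y2 z) + q * sqrt (\<Sum>z\<in>Z. h y1 z) + q * sqrt (\<Sum>z\<in>Z. h y2 z)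
         + q\<^sup>2 * sqrt (real (card Z)))"
      unfolding g_def using q c MN h
      by (intro jumbled_product_weight_le[OF j fin]) (auto simp: s_def)
    also have "\<dots> \<le> 2 * (c * p\<^sup>2 * sqrt (M * N)) * sqrt M *
       (sqrt (\<Sum>z\<in>Z. b y1 z * b y2 z) + (2 * p) * sqrt (2 * N) + (2 * p) * sqrt (2 * N) + (4 * p) * sqrt N)"
    proof -
      have hh: "sqrt (\<Sum>z\<in>Z. h y1 z * h y2 z) \<le> sqrt (\<Sum>z\<in>Z. b y1 z * b y2 z)"
        using hb h01 b01 by (intro real_sqrt_le_mono sum_mono mult_mono) auto
      have hd: "q * sqrt (\<Sum>z\<in>Z. h y z) \<le> (2 * p) * sqrt (2 * N)" if "y \<in> Y" for y
      proof -
        have "(\<Sum>z\<in>Z. h y z) \<le> (\<Sum>z\<in>Z. b y z)" using hb by (intro sum_mono) auto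
        also have "\<dots> \<le> 2 * p * N" by (rule degY[OF that])
        also have "\<dots> \<le> 2 * N" using p MN by simp
        finally have "sqrt (\<Sum>z\<in>Z. h y z) \<le> sqrt (2 * N)" by (rule real_sqrt_le_mono)
        moreover have "0 \<le> sqrt (\<Sum>z\<in>Z. h y z)" by (simp add: sum_nonneg h01)
        ultimately show ?thesis using q by (intro mult_mono) auto
      qed
      have qq: "q\<^sup>2 * sqrt (real (card Z)) \<le> (4 * p) * sqrt N"
      proof (intro mult_mono real_sqrt_le_mono card)
        have "q\<^sup>2 \<le> (2 * p)\<^sup>2" using q by (intro power_mono) auto
        also have "\<dots> = 4 * p * p" by (simp add: power2_eq_square)
        also have "\<dots> \<le> 4 * p * 1" using p by (intro mult_left_mono) auto
        finally show "q\<^sup>2 \<le> 4 * p" by simp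
      qed (use p in auto)
      have nn: "0 \<le> sqrt (\<Sum>z\<in>Z. h y1 z * h y2 z) + q * sqrt (\<Sum>z\<in>Z. h y1 z) + q * sqrt (\<Sum>z\<in>Z. h y2 z)
         + q\<^sup>2 * sqrt (real (card Z))"
        using q h01 by (intro add_nonneg_nonneg mult_nonneg_nonneg) (auto simp: sum_nonneg)
      have C: "2 * (c * p\<^sup>2 * sqrt (M * N)) * sqrt (real (card Y)) \<le> 2 * (c * p\<^sup>2 * sqrt (M * N)) * sqrt M"
        using card c MN by (intro mult_left_mono real_sqrt_le_mono) auto
      show ?thesis
        using hh hd[OF y(1)] hd[OF y(2)] qq c MN
        by (intro mult_mono[OF C _ _ nn]) (linarith, simp)
    qed
    also have "\<dots> \<le> 2 * c * p\<^sup>2 * M * sqrt N * (sqrt (\<Sum>z\<in>Z. b y1 z * b y2 z) + 10 * p * sqrt N)"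
    proof -
      have "sqrt (2 * N) \<le> 3/2 * sqrt N"
        using MN by (intro real_le_lsqrt) (auto simp: power_mult_distrib power_divide)
      then have "p * sqrt (2 * N) \<le> p * (3/2 * sqrt N)" using p by (intro mult_left_mono) auto
      moreover have "0 \<le> p * sqrt N" using p MN by simp
      ultimately have "sqrt (\<Sum>z\<in>Z. b y1 z * b y2 z) + (2 * p) * sqrt (2 * N) + (2 * p) * sqrt (2 * N) + (4 * p) * sqrt N
          \<le> sqrt (\<Sum>z\<in>Z. b y1 z * b y2 z) + 10 * p * sqrt N"
        by linarith
      moreover have C: "2 * (c * p\<^sup>2 * sqrt (M * N)) * sqrt M = 2 * c * p\<^sup>2 * M * sqrt N"
        using MN by (simp add: real_sqrt_mult)
      moreover have "0 \<le> 2 * c * p\<^sup>2 * M * sqrt N" using c MN by simp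
      ultimately show ?thesis unfolding C by (intro mult_left_mono)
    qed
    finally show ?thesis .
  qed
  have codeg: "(\<Sum>y1\<in>Y. \<Sum>y2\<in>Y. \<Sum>z\<in>Z. b y1 z * b y2 z) \<le> 4 * p\<^sup>2 * M\<^sup>2 * N"
  proof -
    have "(\<Sum>y1\<in>Y. \<Sum>y2\<in>Y. \<Sum>z\<in>Z. b y1 z * b y2 z) = (\<Sum>z\<in>Z. (\<Sum>y\<in>Y. b y z)\<^sup>2)"
    proof -
      have "(\<Sum>y1\<in>Y. \<Sum>y2\<in>Y. \<Sum>z\<in>Z. b y1 z * b y2 z) = (\<Sum>y1\<in>Y. \<Sum>z\<in>Z. \<Sum>y2\<in>Y. b y1 z * b y2 z)"
        by (intro sum.cong refl sum.swap)
      also have "\<dots> = (\<Sum>z\<in>Z. \<Sum>y1\<in>Y. \<Sum>y2\<in>Y. b y1 z * b y2 z)" by (rule sum.swap)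
      finally show ?thesis unfolding power2_eq_square sum_product .
    qed
    also have "\<dots> \<le> (\<Sum>z\<in>Z. (2 * p * M)\<^sup>2)"
      using degZ b01 by (intro sum_mono power_mono) (auto simp: sum_nonneg)
    also have "\<dots> \<le> N * (2 * p * M)\<^sup>2" using card by (simp add: mult_right_mono)
    finally show ?thesis by (simp add: power_mult_distrib mult_ac)
  qed
  have sqrt_codeg: "(\<Sum>y1\<in>Y. \<Sum>y2\<in>Y. sqrt (\<Sum>z\<in>Z. b y1 z * b y2 z)) \<le> 5/2 * p * M\<^sup>2 * sqrt N"
  proof -
    \<comment> \<open>The parameter is the typical value of the square root of a codegree.\<close>
    have a: "p * sqrt N > 0" using p MN by simp
    have "(\<Sum>y1\<in>Y. \<Sum>y2\<in>Y. sqrt (\<Sum>z\<in>Z. b y1 z * b y2 z))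
        \<le> (\<Sum>y1\<in>Y. \<Sum>y2\<in>Y. (\<Sum>z\<in>Z. b y1 z * b y2 z) / (2 * (p * sqrt N)) + (p * sqrt N) / 2)"
      using a b01 by (intro sum_mono sqrt_le_AM_GM) (auto simp: sum_nonneg)
    also have "\<dots> = (\<Sum>y1\<in>Y. \<Sum>y2\<in>Y. \<Sum>z\<in>Z. b y1 z * b y2 z) / (2 * (p * sqrt N))
        + real (card Y) * (real (card Y) * ((p * sqrt N) / 2))"
      by (simp add: sum.distrib sum_divide_distrib)
    also have "\<dots> \<le> (4 * p\<^sup>2 * M\<^sup>2 * N) / (2 * (p * sqrt N)) + M * (M * ((p * sqrt N) / 2))"
      using codeg card a p MN by (intro add_mono divide_right_mono mult_mono) auto
    also have "\<dots> = 5/2 * p * M\<^sup>2 * sqrt N"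
    proof -
      have "(4 * p\<^sup>2 * M\<^sup>2 * N) / (2 * (p * sqrt N)) = 2 * p * M\<^sup>2 * (N / sqrt N)"
        using p by (simp add: power2_eq_square)
      also have "N / sqrt N = sqrt N" using MN by (simp add: real_div_sqrt)
      finally show ?thesis by (simp add: power2_eq_square)
    qed
    finally show ?thesis .
  qed
  have F_err: "(\<Sum>y\<in>Y. \<Sum>z\<in>Z. (b y z - p) * (F y z)\<^sup>2) \<le> 25 * c * p^3 * M^3 * N"
  proof -
    have "(\<Sum>y\<in>Y. \<Sum>z\<in>Z. (b y z - p) * (F y z)\<^sup>2) =
       (\<Sum>y\<in>Y. \<Sum>z\<in>Z. \<Sum>y1\<in>Y. \<Sum>y2\<in>Y. ((s y y1 * s y y2) * (b y z - p)) * (g y1 z * g y2 z))"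
      unfolding F_def power2_eq_square sum_product
      unfolding sum_distrib_left
      by (intro sum.cong refl) (simp only: mult_ac)
    also have "\<dots> = (\<Sum>y1\<in>Y. \<Sum>y2\<in>Y. \<Sum>z\<in>Z. \<Sum>y\<in>Y. ((s y y1 * s y y2) * (b y z - p)) * (g y1 z * g y2 z))"
    proof -
      have "(\<Sum>y\<in>Y. \<Sum>z\<in>Z. \<Sum>y1\<in>Y. \<Sum>y2\<in>Y. f y z y1 y2) = (\<Sum>y1\<in>Y. \<Sum>y2\<in>Y. \<Sum>z\<in>Z. \<Sum>y\<in>Y. f y z y1 y2)"
        for f :: "'u \<Rightarrow> 'v \<Rightarrow> 'u \<Rightarrow> 'u \<Rightarrow> real"
      proof -
        have "(\<Sum>y\<in>Y. \<Sum>z\<in>Z. \<Sum>y1\<in>Y. \<Sum>y2\<in>Y. f y z y1 y2) = (\<Sum>z\<in>Z. \<Sum>y\<in>Y. \<Sum>y1\<in>Y. \<Sum>y2\<in>Y. f y z y1 y2)"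
          by (rule sum.swap)
        also have "\<dots> = (\<Sum>z\<in>Z. \<Sum>y1\<in>Y. \<Sum>y\<in>Y. \<Sum>y2\<in>Y. f y z y1 y2)"
          by (intro sum.cong refl sum.swap)
        also have "\<dots> = (\<Sum>z\<in>Z. \<Sum>y1\<in>Y. \<Sum>y2\<in>Y. \<Sum>y\<in>Y. f y z y1 y2)"
          by (intro sum.cong refl sum.swap)
        also have "\<dots> = (\<Sum>y1\<in>Y. \<Sum>z\<in>Z. \<Sum>y2\<in>Y. \<Sum>y\<in>Y. f y z y1 y2)" by (rule sum.swap)
        also have "\<dots> = (\<Sum>y1\<in>Y. \<Sum>y2\<in>Y. \<Sum>z\<in>Z. \<Sum>y\<in>Y. f y z y1 y2)"
          by (intro sum.cong refl sum.swap)
        finally show ?thesis .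
      qed
      then show ?thesis .
    qed
    also have "\<dots> \<le> (\<Sum>y1\<in>Y. \<Sum>y2\<in>Y. 2 * c * p\<^sup>2 * M * sqrt N * (sqrt (\<Sum>z\<in>Z. b y1 z * b y2 z) + 10 * p * sqrt N))"
    proof (intro sum_mono)
      fix y1 y2 assume "y1 \<in> Y" "y2 \<in> Y"
      from pair[OF this] show "(\<Sum>z\<in>Z. \<Sum>y\<in>Y. ((s y y1 * s y y2) * (b y z - p)) * (g y1 z * g y2 z))
        \<le> 2 * c * p\<^sup>2 * M * sqrt N * (sqrt (\<Sum>z\<in>Z. b y1 z * b y2 z) + 10 * p * sqrt N)"
        unfolding sum_distrib_right by linarith
    qed
    also have "\<dots> = 2 * c * p\<^sup>2 * M * sqrt N * ((\<Sum>y1\<in>Y. \<Sum>y2\<in>Y. sqrt (\<Sum>z\<in>Z. b y1 z * b y2 z))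
        + real (card Y) * (real (card Y) * (10 * p * sqrt N)))"
      unfolding sum_distrib_left[symmetric] sum.distrib sum_constant by (simp only: mult_ac)
    also have "\<dots> \<le> 2 * c * p\<^sup>2 * M * sqrt N * (5/2 * p * M\<^sup>2 * sqrt N + M * (M * (10 * p * sqrt N)))"
      using sqrt_codeg card c p MN by (intro mult_left_mono add_mono mult_mono) auto
    also have "\<dots> = 25 * c * p^3 * M^3 * (sqrt N)\<^sup>2"
      by (simp add: algebra_simps power2_eq_square power3_eq_cube)
    finally show ?thesis using MN by simp
  qed
  have b_F_sq: "(\<Sum>y\<in>Y. \<Sum>z\<in>Z. b y z * (F y z)\<^sup>2) \<le> \<mu>\<^sup>2 * (p^3 * M^3 * N)"
  proof -
    have "(\<Sum>y\<in>Y. \<Sum>z\<in>Z. b y z * (F y z)\<^sup>2)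
        = (\<Sum>y\<in>Y. \<Sum>z\<in>Z. (b y z - p) * (F y z)\<^sup>2) + p * (\<Sum>y\<in>Y. \<Sum>z\<in>Z. (F y z)\<^sup>2)"
      unfolding sum_distrib_left sum.distrib[symmetric]
      by (intro sum.cong refl) (simp add: algebra_simps)
    also have "\<dots> \<le> 25 * c * p^3 * M^3 * N + p * (16 * \<eta> * p\<^sup>2 * M^3 * N)"
      using F_err F_sq p by (intro add_mono mult_left_mono) auto
    also have "\<dots> = (16 * \<eta> + 25 * c) * (p^3 * M^3 * N)"
      by (simp add: algebra_simps power2_eq_square power3_eq_cube)
    also have "\<dots> \<le> \<mu>\<^sup>2 * (p^3 * M^3 * N)"
      using \<mu> p MN by (intro mult_right_mono) auto
    finally show ?thesis .
  qed
  have b_F: "(\<Sum>y\<in>Y. \<Sum>z\<in>Z. b y z * \<bar>F y z\<bar>) \<le> 3/2 * \<mu> * p\<^sup>2 * M\<^sup>2 * N"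
  proof -
    \<comment> \<open>AM-GM with parameter \<open>l\<close>, which makes both halves of order \<open>\<mu> p\<^sup>2 M\<^sup>2 N\<close>.\<close>
    define l where "l = \<mu> * p * M"
    have l: "l > 0" using \<mu> p MN by (simp add: l_def)
    have "(\<Sum>y\<in>Y. \<Sum>z\<in>Z. b y z * \<bar>F y z\<bar>) \<le> (\<Sum>y\<in>Y. \<Sum>z\<in>Z. b y z * ((F y z)\<^sup>2 / (2 * l) + l / 2))"
    proof (intro sum_mono mult_left_mono b01)
      fix y z
      show "\<bar>F y z\<bar> \<le> (F y z)\<^sup>2 / (2 * l) + l / 2"
        using sqrt_le_AM_GM[of "(F y z)\<^sup>2" l] l by simp
    qed
    also have "\<dots> = (\<Sum>y\<in>Y. \<Sum>z\<in>Z. b y z * (F y z)\<^sup>2) / (2 * l) + (\<Sum>y\<in>Y. \<Sum>z\<in>Z. b y z) * (l / 2)"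
      unfolding sum_divide_distrib sum_distrib_right sum.distrib[symmetric]
      by (intro sum.cong refl) (simp add: algebra_simps)
    also have "\<dots> \<le> (\<mu>\<^sup>2 * (p^3 * M^3 * N)) / (2 * l) + (2 * p * M * N) * (l / 2)"
      using b_F_sq b_all l by (intro add_mono divide_right_mono mult_right_mono) auto
    also have "\<dots> = 3/2 * \<mu> * p\<^sup>2 * M\<^sup>2 * N"
    proof -
      have A: "\<mu>\<^sup>2 * (p^3 * M^3 * N) = (\<mu> * p\<^sup>2 * M\<^sup>2 * N) * l"
        by (simp add: l_def power2_eq_square power3_eq_cube)
      have "(\<mu>\<^sup>2 * (p^3 * M^3 * N)) / (2 * l) = (\<mu> * p\<^sup>2 * M\<^sup>2 * N) / 2"
        unfolding A using l by simp
      then show ?thesis by (simp add: l_def power2_eq_square)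
    qed
    finally show ?thesis .
  qed
  have "(\<Sum>y\<in>Y. \<Sum>y'\<in>Y. \<bar>K y y'\<bar>) = (\<Sum>y\<in>Y. \<Sum>z\<in>Z. g y z * F y z)"
  proof (rule sum.cong[OF refl])
    fix y
    have "(\<Sum>y'\<in>Y. \<bar>K y y'\<bar>) = (\<Sum>y'\<in>Y. s y y' * K y y')"
      by (intro sum.cong) (auto simp: s_def)
    also have "\<dots> = (\<Sum>y'\<in>Y. \<Sum>z\<in>Z. g y z * (s y y' * g y' z))"
      unfolding K_def sum_distrib_left by (simp add: mult_ac)
    also have "\<dots> = (\<Sum>z\<in>Z. g y z * F y z)"
      unfolding F_def sum_distrib_left by (rule sum.swap)
    finally show "(\<Sum>y'\<in>Y. \<bar>K y y'\<bar>) = (\<Sum>z\<in>Z. g y z * F y z)" .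
  qed
  also have "\<dots> \<le> (\<Sum>y\<in>Y. \<Sum>z\<in>Z. (b y z + 2 * p) * \<bar>F y z\<bar>)"
  proof (intro sum_mono)
    fix y z
    have "g y z * F y z \<le> \<bar>g y z\<bar> * \<bar>F y z\<bar>" by (metis abs_ge_self abs_mult)
    also have "\<dots> \<le> (b y z + 2 * p) * \<bar>F y z\<bar>" using g_abs by (intro mult_right_mono) auto
    finally show "g y z * F y z \<le> (b y z + 2 * p) * \<bar>F y z\<bar>" .
  qed
  also have "\<dots> = (\<Sum>y\<in>Y. \<Sum>z\<in>Z. b y z * \<bar>F y z\<bar>) + 2 * p * (\<Sum>y\<in>Y. \<Sum>z\<in>Z. \<bar>F y z\<bar>)"
    unfolding sum_distrib_left sum.distrib[symmetric]
      by (intro sum.cong refl) (simp add: algebra_simps)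
  also have "\<dots> \<le> 3/2 * \<mu> * p\<^sup>2 * M\<^sup>2 * N + 2 * p * (M * (4 * \<eta> * p * M * N))"
    using b_F F_all p by (intro add_mono mult_left_mono) auto
  also have "\<dots> = (3/2 * \<mu> + 8 * \<eta>) * (p\<^sup>2 * M\<^sup>2 * N)"
    by (simp add: algebra_simps power2_eq_square)
  also have "\<dots> \<le> (3 * \<mu>) * (p\<^sup>2 * M\<^sup>2 * N)"
  proof (intro mult_right_mono)
    have "\<mu>\<^sup>2 \<le> \<mu>" using \<mu> by (simp add: power2_eq_square)
    then show "3/2 * \<mu> + 8 * \<eta> \<le> 3 * \<mu>" using \<mu> c by linarith
  qed (use MN in auto)
  finally show ?thesis unfolding K_def g_def by (simp add: mult_ac)
qed

section \<open>Weighting pairs by their codegree\<close>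

text \<open>With \<open>S\<close> the neighbourhood of a vertex of degree at most \<open>2 p N\<close>, the sums are codegrees, and the
  expected codegree is at most half of the threshold; hence jumbledness applies with deviation \<open>2 \<tau> N\<close>.\<close>

lemma jumbled_few_large_codegrees:
  assumes j: "jumbled p \<gamma> b U V" and S: "S \<subseteq> U" "real (card S) \<le> 2 * p * N" and V: "finite V"
    and p: "p > 0" and N: "N > 0" and \<tau>: "\<tau> \<ge> p\<^sup>2"
  shows "2 * \<tau>\<^sup>2 * N * real (card {v\<in>V. (\<Sum>u\<in>S. b u v) > 4 * \<tau> * N}) \<le> \<gamma>\<^sup>2 * p"
proof -
  let ?D = "{v\<in>V. (\<Sum>u\<in>S. b u v) > 4 * \<tau> * N}"
  have \<tau>0: "\<tau> > 0" using \<tau> p by (smt (verit) zero_less_power)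
  have "p * real (card S) \<le> p * (2 * p * N)" using S p by (intro mult_left_mono) auto
  also have "\<dots> = 2 * N * p\<^sup>2" by (simp add: power2_eq_square)
  also have "\<dots> \<le> 2 * N * \<tau>" using \<tau> N by (intro mult_left_mono) auto
  finally have "p * real (card S) + 2 * \<tau> * N \<le> 4 * \<tau> * N" by (simp add: mult_ac)
  then have "\<forall>v\<in>?D. (\<Sum>u\<in>S. b u v) \<ge> p * real (card S) + 2 * \<tau> * N"
    by (smt (verit) mem_Collect_eq)
  moreover have "2 * \<tau> * N > 0" using \<tau>0 N by simp
  ultimately have "(2 * \<tau> * N)\<^sup>2 * real (card ?D) \<le> \<gamma>\<^sup>2 * real (card S)"
    using V by (intro jumbled_few_exceptional[OF j S(1)] disjI1) simp_all
  also have "\<dots> \<le> \<gamma>\<^sup>2 * (2 * p * N)" using S by (intro mult_left_mono) auto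
  finally have "(2 * N) * (2 * \<tau>\<^sup>2 * N * real (card ?D)) \<le> (2 * N) * (\<gamma>\<^sup>2 * p)"
    by (simp add: power2_eq_square mult_ac)
  then show ?thesis using N by (simp add: mult_ac)
qed

text \<open>The square root \<open>r\<close> of \<open>p\<close> keeps all exponents integral: \<open>r^3\<close> is \<open>p powr (3/2)\<close>. For a set \<open>D\<close> of
  relative size \<open>\<kappa>\<^sup>2\<close> with \<open>\<kappa> \<le> c\<close> the bound is of order \<open>c \<kappa>\<close> and not \<open>\<kappa>\<^sup>2\<close>; this loss
  decides how the exceptional sets below are cut into levels.\<close>

lemma jumbled_edges_to_small_set:
  assumes j: "jumbled p (c * r^3 * sqrt (L * M)) a X Y" and pr: "p = r\<^sup>2" "r > 0" and c: "c \<ge> 0"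
    and LM: "L > 0" "M > 0" and \<kappa>: "\<kappa> \<ge> 0"
    and P: "P \<subseteq> X" "real (card P) \<le> 2 * p * L" and D: "D \<subseteq> Y" "real (card D) \<le> \<kappa>\<^sup>2 * M"
  shows "(\<Sum>x\<in>P. \<Sum>y\<in>D. a x y) \<le> 2 * (\<kappa> + c) * \<kappa> * p\<^sup>2 * L * M"
proof -
  have prod: "real (card P) * real (card D) \<le> (2 * p * L) * (\<kappa>\<^sup>2 * M)"
    using P D pr LM by (intro mult_mono) auto
  have "sqrt (real (card P) * real (card D)) \<le> sqrt ((2 * p * L) * (\<kappa>\<^sup>2 * M))"
    using prod by (rule real_sqrt_le_mono)
  also have "\<dots> = sqrt 2 * (r * \<kappa> * sqrt (L * M))"
    using pr \<kappa> by (simp add: real_sqrt_mult)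
  also have "\<dots> \<le> 2 * (r * \<kappa> * sqrt (L * M))"
    using pr \<kappa> LM sqrt2_less_2 by (intro mult_right_mono) auto
  finally have s: "sqrt (real (card P) * real (card D)) \<le> 2 * (r * \<kappa> * sqrt (L * M))" .
  have "(\<Sum>x\<in>P. \<Sum>y\<in>D. a x y) \<le> p * real (card P) * real (card D)
      + (c * r^3 * sqrt (L * M)) * sqrt (real (card P) * real (card D))"
    by (rule jumbled_upper[OF j P(1) D(1)])
  also have "\<dots> \<le> p * ((2 * p * L) * (\<kappa>\<^sup>2 * M)) + (c * r^3 * sqrt (L * M)) * (2 * (r * \<kappa> * sqrt (L * M)))"
    unfolding mult.assoc[of p "real (card P)"]
    using prod s c pr LM by (intro add_mono mult_left_mono) auto
  also have "\<dots> = 2 * p\<^sup>2 * \<kappa>\<^sup>2 * L * M + 2 * c * \<kappa> * r^4 * (sqrt (L * M))\<^sup>2"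
    by (simp add: power2_eq_square power3_eq_cube power4_eq_xxxx mult_ac)
  also have "\<dots> = 2 * (\<kappa> + c) * \<kappa> * p\<^sup>2 * L * M"
    using LM pr by (simp add: algebra_simps power2_eq_square power4_eq_xxxx)
  finally show ?thesis .
qed

text \<open>The weight \<open>w y'\<close> stands for \<open>\<bar>K(y,y')\<bar>\<close>, which is of order \<open>p\<^sup>2 N\<close> unless the codegree of \<open>y\<close> and
  \<open>y'\<close> into \<open>Z\<close> is large. Pairs with codegree at most \<open>4 p\<^sup>2 L\<close> into \<open>X\<close> give the first term. The others are
  split by their codegree into \<open>Z\<close> at the levels \<open>4 p\<^sup>2 N\<close> and \<open>4 p^(3/2) N\<close>, the maximum being
  \<open>2 p N\<close>. A factor of \<open>p^(1/2)\<close> between consecutive levels is affordable because the relative size of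
  the set above the first level already carries a factor \<open>p\<close>.\<close>

lemma sum_codegree_weight_le:
  fixes a :: "'x \<Rightarrow> 'u \<Rightarrow> real" and b :: "'u \<Rightarrow> 'v \<Rightarrow> real"
  assumes fin: "finite X" "finite Y" "finite Z" and pos: "L > 0" "M > 0" "N > 0"
    and pr: "p = r\<^sup>2" "0 < r" "r \<le> 1" and c: "c \<ge> 0"
    and a: "\<And>x y. a x y = 0 \<or> a x y = 1" and b: "\<And>y z. b y z = 0 \<or> b y z = 1"
    and degX: "(\<Sum>x\<in>X. a x y) \<le> 2 * p * L" and degZ: "(\<Sum>z\<in>Z. b y z) \<le> 2 * p * N"
    and jX: "jumbled p (c * r^3 * sqrt (L * M)) a X Y"
    and jZ: "jumbled p (c * p\<^sup>2 * sqrt (M * N)) b Y Z"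
    and w: "\<And>y'. 0 \<le> w y'" "\<And>y'. y' \<in> Y \<Longrightarrow> w y' \<le> (\<Sum>z\<in>Z. b y z * b y' z) + 12 * p\<^sup>2 * N"
  shows "(\<Sum>y'\<in>Y. w y' * (\<Sum>x\<in>X. a x y * a x y'))
    \<le> 4 * p\<^sup>2 * L * (\<Sum>y'\<in>Y. w y') + 160 * c\<^sup>2 * p^4 * L * M * N"
proof -
  define P where "P = {x\<in>X. a x y = 1}"
  define Q where "Q = {z\<in>Z. b y z = 1}"
  define k where "k y' = (\<Sum>x\<in>P. a x y')" for y'
  define m where "m y' = (\<Sum>z\<in>Q. b y' z)" for y'
  have a01: "0 \<le> a x y'" "a x y' \<le> 1" for x y' using a[of x y'] by auto
  have b01: "0 \<le> b y' z" "b y' z \<le> 1" for z y' using b[of y' z] by auto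
  have p: "0 < p" "p \<le> 1" using pr by (auto simp: power_le_one)
  have k_eq: "(\<Sum>x\<in>X. a x y * a x y') = k y'" for y'
    unfolding k_def P_def by (rule sum_zero_one_mult) (use fin a in auto)
  have m_eq: "(\<Sum>z\<in>Z. b y z * b y' z) = m y'" for y'
    unfolding m_def Q_def by (rule sum_zero_one_mult) (use fin b in auto)
  have P: "P \<subseteq> X" "real (card P) \<le> 2 * p * L"
    using degX sum_zero_one[OF fin(1), of "\<lambda>x. a x y"] a by (auto simp: P_def)
  have Q: "Q \<subseteq> Z" "real (card Q) \<le> 2 * p * N"
    using degZ sum_zero_one[OF fin(3), of "b y"] b by (auto simp: Q_def)
  have k0: "k y' \<ge> 0" for y' unfolding k_def by (simp add: sum_nonneg a01)
  have m_le: "m y' \<le> 2 * p * N" for y'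
  proof -
    have "m y' \<le> (\<Sum>z\<in>Q. 1)" unfolding m_def by (intro sum_mono b01)
    then show ?thesis using Q by simp
  qed
  have cod: "(\<Sum>y'\<in>D. k y') \<le> 2 * (\<kappa> + c) * \<kappa> * p\<^sup>2 * L * M"
    if "D \<subseteq> Y" "real (card D) \<le> \<kappa>\<^sup>2 * M" "\<kappa> \<ge> 0" for D \<kappa>
    using jumbled_edges_to_small_set[OF jX pr(1,2) c pos(1,2) that(3) P that(1,2)]
    unfolding k_def by (subst sum.swap)

  \<comment> \<open>The thresholds \<open>4 p\<^sup>2 N\<close> and \<open>4 p^(3/2) N\<close>, in terms of \<open>r\<close>, define \<open>D1\<close> and \<open>D2\<close>.\<close>
  define H where "H = {y'\<in>Y. k y' > 4 * p\<^sup>2 * L}"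
  define D1 where "D1 = {y'\<in>Y. m y' > 4 * r^4 * N}"
  define D2 where "D2 = {y'\<in>Y. m y' > 4 * r^3 * N}"
  have H: "real (card H) \<le> c\<^sup>2 * M"
  proof -
    have "2 * (p\<^sup>2)\<^sup>2 * L * real (card H) \<le> (c * r^3 * sqrt (L * M))\<^sup>2 * p"
      unfolding H_def k_def
      using fin p pos by (intro jumbled_few_large_codegrees[OF jX P]) auto
    also have "\<dots> = (p\<^sup>2)\<^sup>2 * L * (c\<^sup>2 * M)"
      using pos by (simp add: pr power_mult_distrib power2_eq_square power3_eq_cube mult_ac)
    finally have "(p\<^sup>2)\<^sup>2 * L * (2 * real (card H)) \<le> (p\<^sup>2)\<^sup>2 * L * (c\<^sup>2 * M)" by (simp add: mult_ac)
    then have "2 * real (card H) \<le> c\<^sup>2 * M" using p pos by simp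
    then show ?thesis by simp
  qed
  have D: "2 * \<tau>\<^sup>2 * real (card {y'\<in>Y. m y' > 4 * \<tau> * N}) \<le> c\<^sup>2 * r^10 * M"
    if \<tau>: "\<tau> \<ge> p\<^sup>2" for \<tau>
  proof -
    have "2 * \<tau>\<^sup>2 * N * real (card {y'\<in>Y. m y' > 4 * \<tau> * N}) \<le> (c * p\<^sup>2 * sqrt (M * N))\<^sup>2 * p"
      unfolding m_def
      using fin p pos \<tau> by (intro jumbled_few_large_codegrees[OF jumbled_transpose[OF jZ] Q]) auto
    also have "\<dots> = N * (c\<^sup>2 * r^10 * M)"
      using pos by (simp add: pr power_mult_distrib mult_ac flip: power_mult power_add)
    finally have "N * (2 * \<tau>\<^sup>2 * real (card {y'\<in>Y. m y' > 4 * \<tau> * N})) \<le> N * (c\<^sup>2 * r^10 * M)"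
      by (simp add: mult_ac)
    then show ?thesis using pos by simp
  qed
  have r43: "r^4 \<le> r^3" using pr by (intro power_decreasing) auto
  have D1: "real (card D1) \<le> (c * r)\<^sup>2 * M"
  proof -
    have "r^8 * (2 * real (card D1)) \<le> r^8 * ((c * r)\<^sup>2 * M)"
      using D[of "r^4"] unfolding D1_def
      by (simp add: pr power_mult_distrib mult_ac flip: power_mult power_add)
    then have "2 * real (card D1) \<le> (c * r)\<^sup>2 * M" using pr by simp
    then show ?thesis by simp
  qed
  have D2: "real (card D2) \<le> (c * r\<^sup>2)\<^sup>2 * M"
  proof -
    have "r^6 * (2 * real (card D2)) \<le> r^6 * ((c * r\<^sup>2)\<^sup>2 * M)"
      using D[of "r^3"] r43 unfolding D2_def
      by (simp add: pr power_mult_distrib mult_ac flip: power_mult power_add)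
    then have "2 * real (card D2) \<le> (c * r\<^sup>2)\<^sup>2 * M" using pr by simp
    then show ?thesis by simp
  qed
  have kH: "(\<Sum>y'\<in>H. k y') \<le> 4 * c\<^sup>2 * r^4 * L * M"
    using cod[of H c] H c by (simp add: H_def pr power2_eq_square power4_eq_xxxx mult_ac)
  have small: "2 * (c * s + c) * (c * s) * p\<^sup>2 * L * M \<le> 4 * c\<^sup>2 * s * r^4 * L * M" if "0 \<le> s" "s \<le> 1" for s
  proof -
    have "2 * (c * s + c) \<le> 4 * c" using that c mult_left_mono[of s 1 c] by simp
    then have "2 * (c * s + c) * ((c * s) * p\<^sup>2 * L * M) \<le> 4 * c * ((c * s) * p\<^sup>2 * L * M)"
      using that c pos by (intro mult_right_mono) auto
    then show ?thesis by (simp add: pr power2_eq_square power4_eq_xxxx mult_ac)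
  qed
  have kD1: "(\<Sum>y'\<in>D1. k y') \<le> 4 * c\<^sup>2 * r^5 * L * M"
  proof -
    have "(\<Sum>y'\<in>D1. k y') \<le> 2 * (c * r + c) * (c * r) * p\<^sup>2 * L * M"
      using D1 c pr by (intro cod) (auto simp: D1_def)
    also have "\<dots> \<le> 4 * c\<^sup>2 * r * r^4 * L * M" using pr by (intro small) auto
    finally show ?thesis by (simp add: eval_nat_numeral mult_ac)
  qed
  have kD2: "(\<Sum>y'\<in>D2. k y') \<le> 4 * c\<^sup>2 * r^6 * L * M"
  proof -
    have "(\<Sum>y'\<in>D2. k y') \<le> 2 * (c * r\<^sup>2 + c) * (c * r\<^sup>2) * p\<^sup>2 * L * M"
      using D2 c pr by (intro cod) (auto simp: D2_def)
    also have "\<dots> \<le> 4 * c\<^sup>2 * r\<^sup>2 * r^4 * L * M" using pr by (intro small) (auto simp: power_le_one)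
    finally show ?thesis by (simp add: eval_nat_numeral mult_ac)
  qed
  have p2: "p\<^sup>2 = r^4" by (simp add: pr flip: power_mult)
  have point: "w y' * k y' \<le> 4 * p\<^sup>2 * L * w y' + ((if y' \<in> H then 16 * r^4 * N * k y' else 0)
      + (if y' \<in> D1 then 16 * r^3 * N * k y' else 0) + (if y' \<in> D2 then 8 * p * N * k y' else 0))"
    (is "_ \<le> ?A + (?B + ?C + ?D)") if y': "y' \<in> Y" for y'
  proof -
    have nn: "0 \<le> ?A" "0 \<le> ?B" "0 \<le> ?C" "0 \<le> ?D"
      using w(1)[of y'] k0[of y'] pos pr by auto
    have wm: "w y' \<le> m y' + 12 * r^4 * N" using w(2)[OF y'] unfolding m_eq p2 .
    consider "k y' \<le> 4 * p\<^sup>2 * L" | "y' \<in> H" "m y' \<le> 4 * r^4 * N"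
      | "y' \<in> D1" "m y' \<le> 4 * r^3 * N" "m y' > 4 * r^4 * N" | "y' \<in> D2" "m y' > 4 * r^4 * N"
      using y' unfolding H_def D1_def D2_def by fastforce
    then show ?thesis
    proof cases
      case 1
      then have "k y' * w y' \<le> 4 * p\<^sup>2 * L * w y'" using w(1) by (intro mult_right_mono) auto
      then show ?thesis using nn by (simp add: mult.commute[of "w y'"])
    next
      case 2
      then have "w y' * k y' \<le> 16 * r^4 * N * k y'" using wm k0 by (intro mult_right_mono) auto
      moreover have "?B = 16 * r^4 * N * k y'" using 2 by simp
      ultimately show ?thesis using nn by linarith
    next
      case 3
      then have "w y' * k y' \<le> 16 * r^3 * N * k y'" using wm k0 by (intro mult_right_mono) auto
      moreover have "?C = 16 * r^3 * N * k y'" using 3 by simp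
      ultimately show ?thesis using nn by linarith
    next
      case 4
      then have "w y' * k y' \<le> 8 * p * N * k y'" using wm k0 m_le[of y'] by (intro mult_right_mono) auto
      moreover have "?D = 8 * p * N * k y'" using 4 by simp
      ultimately show ?thesis using nn by linarith
    qed
  qed
  have restrict: "(\<Sum>y'\<in>Y. if y' \<in> T then t * k y' else 0) = t * (\<Sum>y'\<in>T. k y')" if "T \<subseteq> Y" for T t
    using that fin(2) by (simp add: sum.If_cases Int_absorb1 Collect_mem_eq sum_distrib_left)
  have "(\<Sum>y'\<in>Y. w y' * k y') \<le> (\<Sum>y'\<in>Y. 4 * p\<^sup>2 * L * w y' + ((if y' \<in> H then 16 * r^4 * N * k y' else 0)
      + (if y' \<in> D1 then 16 * r^3 * N * k y' else 0) + (if y' \<in> D2 then 8 * p * N * k y' else 0)))"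
    by (intro sum_mono point)
  also have "\<dots> = 4 * p\<^sup>2 * L * (\<Sum>y'\<in>Y. w y') + (16 * r^4 * N * (\<Sum>y'\<in>H. k y')
      + 16 * r^3 * N * (\<Sum>y'\<in>D1. k y') + 8 * p * N * (\<Sum>y'\<in>D2. k y'))"
    unfolding sum.distrib by (subst (1 2 3) restrict) (auto simp: H_def D1_def D2_def sum_distrib_left)
  also have "\<dots> \<le> 4 * p\<^sup>2 * L * (\<Sum>y'\<in>Y. w y') + (16 * r^4 * N * (4 * c\<^sup>2 * r^4 * L * M)
      + 16 * r^3 * N * (4 * c\<^sup>2 * r^5 * L * M) + 8 * p * N * (4 * c\<^sup>2 * r^6 * L * M))"
    using kH kD1 kD2 pos p pr by (intro add_left_mono add_mono mult_left_mono) auto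
  also have "\<dots> = 4 * p\<^sup>2 * L * (\<Sum>y'\<in>Y. w y') + 160 * c\<^sup>2 * p^4 * L * M * N"
    by (simp add: pr algebra_simps flip: power_mult power_add)
  finally show ?thesis unfolding k_eq .
qed

section \<open>Discrepancy inside typical neighbourhoods\<close>

text \<open>Cauchy-Schwarz over \<open>z\<close>, after enlarging \<open>T\<close> to \<open>Z\<close>, and expansion of the square.\<close>

lemma discrepancy_sq_le_codegree_sum:
  fixes g :: "'u \<Rightarrow> 'v \<Rightarrow> real"
  assumes "finite Z" "T \<subseteq> Z"
  shows "(\<Sum>y\<in>S. \<Sum>z\<in>T. g y z)\<^sup>2
    \<le> real (card Z) * (\<Sum>y\<in>S. \<Sum>y'\<in>S. \<bar>\<Sum>z\<in>Z. g y z * g y' z\<bar>)"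
proof -
  have T: "finite T" using assms finite_subset by auto
  have "(\<Sum>y\<in>S. \<Sum>z\<in>T. g y z)\<^sup>2 = (\<Sum>z\<in>T. \<Sum>y\<in>S. g y z)\<^sup>2" by (subst sum.swap) simp
  also have "\<dots> \<le> (\<Sum>z\<in>T. (\<Sum>y\<in>S. g y z)\<^sup>2) * real (card T)"
    using sum_squared_le_sum_of_squares T by blast
  also have "\<dots> \<le> (\<Sum>z\<in>Z. (\<Sum>y\<in>S. g y z)\<^sup>2) * real (card Z)"
    using assms by (intro mult_mono sum_mono2) (auto simp: card_mono sum_nonneg)
  also have "(\<Sum>z\<in>Z. (\<Sum>y\<in>S. g y z)\<^sup>2) = (\<Sum>y\<in>S. \<Sum>y'\<in>S. \<Sum>z\<in>Z. g y z * g y' z)"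
  proof -
    have "(\<Sum>z\<in>Z. (\<Sum>y\<in>S. g y z)\<^sup>2) = (\<Sum>y\<in>S. \<Sum>z\<in>Z. \<Sum>y'\<in>S. g y z * g y' z)"
      unfolding power2_eq_square sum_product by (rule sum.swap)
    also have "\<dots> = (\<Sum>y\<in>S. \<Sum>y'\<in>S. \<Sum>z\<in>Z. g y z * g y' z)"
      by (intro sum.cong refl sum.swap)
    finally show ?thesis .
  qed
  also have "\<dots> * real (card Z) \<le> (\<Sum>y\<in>S. \<Sum>y'\<in>S. \<bar>\<Sum>z\<in>Z. g y z * g y' z\<bar>) * real (card Z)"
    by (intro mult_right_mono sum_mono) auto
  finally show ?thesis by (simp add: mult.commute)
qed

lemma abs_codegree_deviation_le:
  fixes b h :: "'u \<Rightarrow> 'v \<Rightarrow> real"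
  assumes h: "\<And>y z. 0 \<le> h y z" "\<And>y z. h y z \<le> b y z" and q: "0 \<le> q" "q \<le> 2 * p"
    and card: "real (card Z) \<le> N" and p: "p > 0"
    and deg: "(\<Sum>z\<in>Z. b y z) \<le> 2 * p * N" "(\<Sum>z\<in>Z. b y' z) \<le> 2 * p * N"
  shows "\<bar>\<Sum>z\<in>Z. (h y z - q) * (h y' z - q)\<bar> \<le> (\<Sum>z\<in>Z. b y z * b y' z) + 12 * p\<^sup>2 * N"
proof -
  have "\<bar>\<Sum>z\<in>Z. (h y z - q) * (h y' z - q)\<bar> \<le> (\<Sum>z\<in>Z. \<bar>(h y z - q) * (h y' z - q)\<bar>)" by (rule sum_abs)
  also have "\<dots> \<le> (\<Sum>z\<in>Z. (b y z + 2 * p) * (b y' z + 2 * p))"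
  proof (intro sum_mono)
    fix z
    have "\<bar>h y z - q\<bar> \<le> b y z + 2 * p" "\<bar>h y' z - q\<bar> \<le> b y' z + 2 * p"
      using h[of y z] h[of y' z] q by linarith+
    then show "\<bar>(h y z - q) * (h y' z - q)\<bar> \<le> (b y z + 2 * p) * (b y' z + 2 * p)"
      unfolding abs_mult by (intro mult_mono) auto
  qed
  also have "\<dots> = (\<Sum>z\<in>Z. b y z * b y' z) + 2 * p * (\<Sum>z\<in>Z. b y z) + 2 * p * (\<Sum>z\<in>Z. b y' z) + real (card Z) * (4 * p\<^sup>2)"
    unfolding sum_distrib_left sum_constant[symmetric] sum.distrib[symmetric]
    by (intro sum.cong refl) (simp add: algebra_simps power2_eq_square)
  also have "\<dots> \<le> (\<Sum>z\<in>Z. b y z * b y' z) + 2 * p * (2 * p * N) + 2 * p * (2 * p * N) + N * (4 * p\<^sup>2)"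
    using deg card p by (intro add_mono mult_left_mono mult_right_mono) auto
  also have "\<dots> = (\<Sum>z\<in>Z. b y z * b y' z) + 12 * p\<^sup>2 * N" by (simp add: power2_eq_square)
  finally show ?thesis .
qed

text \<open>Double counting: a pair \<open>y, y'\<close> lies in as many neighbourhoods as its codegree into \<open>X\<close>.\<close>

lemma sum_neighbourhood_pairs:
  fixes a :: "'x \<Rightarrow> 'u \<Rightarrow> real" and K :: "'u \<Rightarrow> 'u \<Rightarrow> real"
  assumes "finite Y" and a: "\<And>x y. a x y = 0 \<or> a x y = 1"
  shows "(\<Sum>x\<in>X. \<Sum>y\<in>{y\<in>Y. a x y = 1}. \<Sum>y'\<in>{y\<in>Y. a x y = 1}. K y y')
    = (\<Sum>y\<in>Y. \<Sum>y'\<in>Y. K y y' * (\<Sum>x\<in>X. a x y * a x y'))"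
proof -
  have inner: "(\<Sum>y\<in>{y\<in>Y. a x y = 1}. \<Sum>y'\<in>{y\<in>Y. a x y = 1}. K y y')
      = (\<Sum>y\<in>Y. \<Sum>y'\<in>Y. K y y' * (a x y * a x y'))" for x
  proof -
    have "(\<Sum>y\<in>{y\<in>Y. a x y = 1}. \<Sum>y'\<in>{y\<in>Y. a x y = 1}. K y y')
        = (\<Sum>y\<in>Y. a x y * (\<Sum>y'\<in>Y. a x y' * K y y'))"
      using assms by (subst sum_zero_one_mult) (auto simp: sum_zero_one_mult)
    then show ?thesis by (simp add: sum_distrib_left mult_ac)
  qed
  have "(\<Sum>x\<in>X. \<Sum>y\<in>Y. \<Sum>y'\<in>Y. K y y' * (a x y * a x y'))
      = (\<Sum>y\<in>Y. \<Sum>x\<in>X. \<Sum>y'\<in>Y. K y y' * (a x y * a x y'))" by (rule sum.swap)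
  also have "\<dots> = (\<Sum>y\<in>Y. \<Sum>y'\<in>Y. \<Sum>x\<in>X. K y y' * (a x y * a x y'))"
    by (intro sum.cong refl sum.swap)
  finally show ?thesis unfolding inner by (simp add: sum_distrib_left)
qed

text \<open>The crude bound for rectangles with an atypical side, where edges need only be few and not well
  distributed.\<close>

lemma jumbled_small_discrepancy:
  fixes b h :: "'u \<Rightarrow> 'v \<Rightarrow> real"
  assumes j: "jumbled p (c * p\<^sup>2 * sqrt (M * N)) b Y Z"
    and h: "\<And>y z. 0 \<le> h y z" "\<And>y z. h y z \<le> b y z" and q: "0 \<le> q" "q \<le> 2 * p"
    and p: "0 < p" "p \<le> 1" and c: "0 \<le> c" "c \<le> 1/2" and MN: "M > 0" "N > 0"
    and S: "S \<subseteq> Y" "T \<subseteq> Z" "real (card S) * real (card T) \<le> 2 * c * p * M * N"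
  shows "\<bar>\<Sum>y\<in>S. \<Sum>z\<in>T. (h y z - q)\<bar> \<le> 7 * c * p\<^sup>2 * M * N"
proof -
  have "\<bar>\<Sum>y\<in>S. \<Sum>z\<in>T. (h y z - q)\<bar> \<le> (\<Sum>y\<in>S. \<Sum>z\<in>T. (b y z + 2 * p))"
  proof (rule order_trans[OF sum_abs] , intro sum_mono, rule order_trans[OF sum_abs], intro sum_mono)
    fix y z show "\<bar>h y z - q\<bar> \<le> b y z + 2 * p" using h[of y z] q by linarith
  qed
  also have "\<dots> = (\<Sum>y\<in>S. \<Sum>z\<in>T. b y z) + 2 * p * (real (card S) * real (card T))"
    by (simp add: sum.distrib)
  also have "\<dots> \<le> 3 * p * (real (card S) * real (card T))
      + (c * p\<^sup>2 * sqrt (M * N)) * sqrt (real (card S) * real (card T))"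
    using jumbled_upper[OF j S(1,2)] by simp
  also have "\<dots> \<le> 3 * p * (2 * c * p * M * N) + (c * p\<^sup>2 * sqrt (M * N)) * sqrt (M * N)"
  proof (intro add_mono mult_left_mono S real_sqrt_le_mono)
    have "(2 * c) * p \<le> 1 * 1" using c p by (intro mult_mono) auto
    then have "2 * c * p * (M * N) \<le> 1 * (M * N)" using MN by (intro mult_right_mono) auto
    then show "real (card S) * real (card T) \<le> M * N" using S(3) by (simp add: mult_ac)
  qed (use c p MN in auto)
  also have "\<dots> = 7 * c * p\<^sup>2 * M * N" using MN by (simp add: power2_eq_square)
  finally show ?thesis .
qed

lemma jumbled_few_low_degrees:
  fixes a :: "'x \<Rightarrow> 'u \<Rightarrow> real"
  assumes j: "jumbled p (c * r^3 * sqrt (real (card X) * real (card Y))) a X Y" and fin: "finite X"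
    and pos: "X \<noteq> {}" "card Y > 0" and pr: "p = r\<^sup>2" "0 < r" "r \<le> 1" and c: "0 \<le> c" "c \<le> 1/2"
  shows "real (card {x\<in>X. (\<Sum>y\<in>Y. a x y) < p * real (card Y) / 2}) \<le> 2 * c * real (card X)"
    (is "real (card ?B) \<le> _")
proof -
  have p: "0 < p" "p \<le> 1" using pr by (auto simp: power_le_one)
  have "(p * real (card Y) / 2)\<^sup>2 * real (card ?B)
      \<le> (c * r^3 * sqrt (real (card X) * real (card Y)))\<^sup>2 * real (card Y)"
    using p pos fin by (intro jumbled_few_exceptional[OF jumbled_transpose[OF j]] disjI2) auto
  also have "\<dots> = (p * real (card Y) / 2)\<^sup>2 * (4 * (c\<^sup>2 * p) * real (card X))"
    by (simp add: pr power_mult_distrib power2_eq_square power3_eq_cube mult_ac)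
  finally have "real (card ?B) \<le> 4 * (c\<^sup>2 * p) * real (card X)" using p pos by simp
  also have "\<dots> \<le> 4 * (c / 2) * real (card X)"
  proof (intro mult_right_mono mult_left_mono)
    have "c\<^sup>2 * p \<le> (c * (1/2)) * 1"
      using c p unfolding power2_eq_square by (intro mult_mono mult_left_mono) auto
    then show "c\<^sup>2 * p \<le> c / 2" by simp
  qed auto
  finally show ?thesis by simp
qed

text \<open>The exceptional vertices of \<open>X\<close> are those of too small (\<open>X1\<close>) or too large (\<open>X2\<close>) degree into \<open>Y\<close>,
  those with many neighbours of atypical degree (\<open>X3\<close>), and those inside whose neighbourhood the codegree
  deviations are large (\<open>X4\<close>). In the discrepancy, \<open>\<delta>\<close> accounts for typical vertices of \<open>Y\<close> and \<open>Z\<close>,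
  and \<open>14 c\<close> for the rectangles that contain an atypical side.\<close>

lemma most_neighbourhoods_have_small_discrepancy:
  fixes a :: "'x \<Rightarrow> 'u \<Rightarrow> real" and b h :: "'u \<Rightarrow> 'v \<Rightarrow> real"
  assumes fin: "finite X" "finite Y" "finite Z"
    and card: "L = real (card X)" "M = real (card Y)" "N = real (card Z)"
    and pos: "L > 0" "M > 0" "N > 0"
    and pr: "p = r\<^sup>2" "0 < r" "r \<le> 1" and q: "0 \<le> q" "q \<le> 2 * p"
    and c: "0 < c" "c \<le> 1/2" and \<mu>: "0 < \<mu>" "\<mu> \<le> 1" "16 * \<eta> + 25 * c \<le> \<mu>\<^sup>2" and \<delta>: "\<delta> > 0"
    and a: "\<And>x y. a x y = 0 \<or> a x y = 1" and b: "\<And>y z. b y z = 0 \<or> b y z = 1"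
    and h: "\<And>y z. h y z = 0 \<or> h y z = 1" and hb: "\<And>y z. h y z \<le> b y z"
    and jX: "jumbled p (c * r^3 * sqrt (L * M)) a X Y"
    and jZ: "jumbled p (c * p\<^sup>2 * sqrt (M * N)) b Y Z"
    and cut: "\<And>S T. S \<subseteq> Y \<Longrightarrow> T \<subseteq> Z \<Longrightarrow> \<bar>\<Sum>y\<in>S. \<Sum>z\<in>T. (h y z - q)\<bar> \<le> \<eta> * p * M * N"
  shows "real (card {x\<in>X. \<not> (p * M / 2 \<le> (\<Sum>y\<in>Y. a x y) \<and>
      (\<forall>S T. S \<subseteq> {y\<in>Y. a x y = 1} \<longrightarrow> T \<subseteq> Z \<longrightarrow>
        \<bar>\<Sum>y\<in>S. \<Sum>z\<in>T. (h y z - q)\<bar> \<le> (\<delta> + 14 * c) * p\<^sup>2 * M * N))})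
    \<le> (7 * c + (12 * \<mu> + 160 * c\<^sup>2) / \<delta>\<^sup>2) * L"
proof -
  have p: "0 < p" "p \<le> 1" using pr by (auto simp: power_le_one)
  have a0: "0 \<le> a x y" for x y using a[of x y] by auto
  have b0: "0 \<le> b y z" for y z using b[of y z] by auto
  have h0: "0 \<le> h y z" for y z using h[of y z] by auto
  have c2: "c\<^sup>2 \<le> c / 2" using c by (simp add: power2_eq_square)
  have g2X: "(c * r^3 * sqrt (L * M))\<^sup>2 = c\<^sup>2 * p^3 * L * M"
    using pos by (simp add: pr power_mult_distrib flip: power_mult)
  have g2Z: "(c * p\<^sup>2 * sqrt (M * N))\<^sup>2 = c\<^sup>2 * p^4 * M * N"
    using pos by (simp add: power_mult_distrib flip: power_mult)

  define dX where "dX y = (\<Sum>x\<in>X. a x y)" for y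
  define dZ where "dZ y = (\<Sum>z\<in>Z. b y z)" for y
  define Y1 where "Y1 = {y\<in>Y. dX y > 2 * p * L}"
  define Y2 where "Y2 = {y\<in>Y. dZ y > 2 * p * N}"
  define Y0 where "Y0 = Y - (Y1 \<union> Y2)"
  define Z1 where "Z1 = {z\<in>Z. (\<Sum>y\<in>Y. b y z) > 2 * p * M}"
  define Z0 where "Z0 = Z - Z1"
  have sub: "Y0 \<subseteq> Y" "Z0 \<subseteq> Z" "Y1 \<subseteq> Y" "Y2 \<subseteq> Y" "Z1 \<subseteq> Z"
    by (auto simp: Y0_def Z0_def Y1_def Y2_def Z1_def)
  have fin0: "finite Y0" "finite Z0" "finite Y1" "finite Y2" "finite Z1"
    using sub fin by (auto intro: finite_subset)
  have Y1: "real (card Y1) \<le> c\<^sup>2 * p * M"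
  proof -
    have "(p * L)\<^sup>2 * real (card Y1) \<le> (c * r^3 * sqrt (L * M))\<^sup>2 * real (card X)"
      using p pos sub fin0
      by (intro jumbled_few_exceptional[OF jX] disjI1) (auto simp: Y1_def dX_def card)
    also have "\<dots> = (p * L)\<^sup>2 * (c\<^sup>2 * p * M)"
      unfolding g2X by (simp add: card power2_eq_square power3_eq_cube mult_ac)
    finally show ?thesis using p pos by simp
  qed
  have Y2: "real (card Y2) \<le> c\<^sup>2 * p * M"
  proof -
    have "(p * N)\<^sup>2 * real (card Y2) \<le> (c * p\<^sup>2 * sqrt (M * N))\<^sup>2 * real (card Z)"
      using p pos sub fin0
      by (intro jumbled_few_exceptional[OF jumbled_transpose[OF jZ]] disjI1) (auto simp: Y2_def dZ_def card)
    also have "\<dots> = (p * N)\<^sup>2 * (c\<^sup>2 * p * M * p)"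
      unfolding g2Z by (simp add: card power2_eq_square power4_eq_xxxx mult_ac)
    finally have "real (card Y2) \<le> c\<^sup>2 * p * M * p" using p pos by simp
    also have "\<dots> \<le> c\<^sup>2 * p * M * 1" using p pos by (intro mult_left_mono) auto
    finally show ?thesis by simp
  qed
  have Z1: "real (card Z1) \<le> c * N"
  proof -
    have "(p * M)\<^sup>2 * real (card Z1) \<le> (c * p\<^sup>2 * sqrt (M * N))\<^sup>2 * real (card Y)"
      using p pos sub fin0
      by (intro jumbled_few_exceptional[OF jZ] disjI1) (auto simp: Z1_def card)
    also have "\<dots> = (p * M)\<^sup>2 * (c\<^sup>2 * N * p\<^sup>2)"
      unfolding g2Z by (simp add: card power2_eq_square power4_eq_xxxx mult_ac)
    finally have "real (card Z1) \<le> c\<^sup>2 * N * p\<^sup>2" using p pos by simp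
    also have "\<dots> \<le> c * N * 1"
      using p pos c c2 by (intro mult_mono) (auto simp: power_le_one)
    finally show ?thesis by simp
  qed

  define K where "K y y' = (\<Sum>z\<in>Z0. (h y z - q) * (h y' z - q))" for y y'
  define nb where "nb x A = {y\<in>A. a x y = 1}" for x A
  define f where "f x = (\<Sum>y\<in>nb x Y0. \<Sum>y'\<in>nb x Y0. \<bar>K y y'\<bar>)" for x
  have Z0deg: "(\<Sum>z\<in>Z0. b y z) \<le> 2 * p * N" if "y \<in> Y0" for y
  proof -
    have "(\<Sum>z\<in>Z0. b y z) \<le> (\<Sum>z\<in>Z. b y z)" using fin sub b0 by (intro sum_mono2) auto
    then show ?thesis using that by (auto simp: Y0_def Y2_def dZ_def)
  qed
  have Xdeg: "(\<Sum>x\<in>X. a x y) \<le> 2 * p * L" if "y \<in> Y0" for y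
    using that by (auto simp: Y0_def Y1_def dX_def)
  have Y0deg: "(\<Sum>y\<in>Y0. b y z) \<le> 2 * p * M" if "z \<in> Z0" for z
  proof -
    have "(\<Sum>y\<in>Y0. b y z) \<le> (\<Sum>y\<in>Y. b y z)" using fin sub b0 by (intro sum_mono2) auto
    then show ?thesis using that by (auto simp: Z0_def Z1_def)
  qed
  have card0: "real (card Y0) \<le> M" "real (card Z0) \<le> N"
    using sub fin by (auto simp: card card_mono)
  have jX0: "jumbled p (c * r^3 * sqrt (L * M)) a X Y0"
    using jX sub by (auto intro: jumbled_subset)
  have jZ0: "jumbled p (c * p\<^sup>2 * sqrt (M * N)) b Y0 Z0"
    using jZ sub by (auto intro: jumbled_subset)
  have K_sum: "(\<Sum>y\<in>Y0. \<Sum>y'\<in>Y0. \<bar>K y y'\<bar>) \<le> 3 * \<mu> * p\<^sup>2 * M\<^sup>2 * N"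
    unfolding K_def
    by (rule sum_abs_codegree_deviation_le[OF fin0(1,2) card0 pos(2,3) p q less_imp_le[OF c(1)] \<mu> b h hb
          Z0deg Y0deg jZ0 cut[OF order_trans[OF _ sub(1)] order_trans[OF _ sub(2)]]])
  have f_sum: "(\<Sum>x\<in>X. f x) \<le> (12 * \<mu> + 160 * c\<^sup>2) * (p^4 * L * M\<^sup>2 * N)"
  proof -
    have "(\<Sum>x\<in>X. f x) = (\<Sum>y\<in>Y0. \<Sum>y'\<in>Y0. \<bar>K y y'\<bar> * (\<Sum>x\<in>X. a x y * a x y'))"
      unfolding f_def nb_def by (rule sum_neighbourhood_pairs[OF fin0(1) a])
    also have "\<dots> \<le> (\<Sum>y\<in>Y0. 4 * p\<^sup>2 * L * (\<Sum>y'\<in>Y0. \<bar>K y y'\<bar>) + 160 * c\<^sup>2 * p^4 * L * M * N)"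
    proof (intro sum_mono)
      fix y assume y: "y \<in> Y0"
      have K: "\<bar>K y y'\<bar> \<le> (\<Sum>z\<in>Z0. b y z * b y' z) + 12 * p\<^sup>2 * N" if "y' \<in> Y0" for y'
        unfolding K_def
        by (rule abs_codegree_deviation_le[OF h0 hb q card0(2) p(1) Z0deg[OF y] Z0deg[OF that]])
      show "(\<Sum>y'\<in>Y0. \<bar>K y y'\<bar> * (\<Sum>x\<in>X. a x y * a x y'))
          \<le> 4 * p\<^sup>2 * L * (\<Sum>y'\<in>Y0. \<bar>K y y'\<bar>) + 160 * c\<^sup>2 * p^4 * L * M * N"
        by (rule sum_codegree_weight_le[OF fin(1) fin0(1,2) pos pr less_imp_le[OF c(1)] a b
              Xdeg[OF y] Z0deg[OF y] jX0 jZ0 abs_ge_zero K])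
    qed
    also have "\<dots> = 4 * p\<^sup>2 * L * (\<Sum>y\<in>Y0. \<Sum>y'\<in>Y0. \<bar>K y y'\<bar>) + real (card Y0) * (160 * c\<^sup>2 * p^4 * L * M * N)"
      unfolding sum.distrib sum_distrib_left[symmetric] by simp
    also have "\<dots> \<le> 4 * p\<^sup>2 * L * (3 * \<mu> * p\<^sup>2 * M\<^sup>2 * N) + M * (160 * c\<^sup>2 * p^4 * L * M * N)"
      using K_sum card0 p pos by (intro add_mono mult_left_mono mult_right_mono) auto
    also have "\<dots> = (12 * \<mu> + 160 * c\<^sup>2) * (p^4 * L * M\<^sup>2 * N)"
      by (simp add: algebra_simps power2_eq_square power4_eq_xxxx)
    finally show ?thesis .
  qed

  define X1 where "X1 = {x\<in>X. (\<Sum>y\<in>Y. a x y) < p * M / 2}"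
  define X2 where "X2 = {x\<in>X. (\<Sum>y\<in>Y. a x y) > 2 * p * M}"
  define X3 where "X3 = {x\<in>X. (\<Sum>y\<in>Y1 \<union> Y2. a x y) > c * p * M}"
  define X4 where "X4 = {x\<in>X. f x > \<delta>\<^sup>2 * p^4 * M\<^sup>2 * N}"
  have finX: "finite X1" "finite X2" "finite X3" "finite X4"
    using fin by (auto simp: X1_def X2_def X3_def X4_def)
  have cp: "c\<^sup>2 * p \<le> c / 2" using mult_mono[of "c\<^sup>2" "c/2" p 1] c c2 p by simp
  have X1: "real (card X1) \<le> 2 * c * L"
    unfolding X1_def card
    by (rule jumbled_few_low_degrees[OF jX[unfolded card] fin(1) _ _ pr])
      (use pos c in \<open>auto simp: card\<close>)
  have X2: "real (card X2) \<le> c * L"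
  proof -
    have "(p * M)\<^sup>2 * real (card X2) \<le> (c * r^3 * sqrt (L * M))\<^sup>2 * real (card Y)"
      using p pos finX
      by (intro jumbled_few_exceptional[OF jumbled_transpose[OF jX]] disjI1) (auto simp: X2_def card)
    also have "\<dots> = (p * M)\<^sup>2 * ((c\<^sup>2 * p) * L)"
      unfolding g2X by (simp add: card power2_eq_square power3_eq_cube mult_ac)
    finally have "real (card X2) \<le> (c\<^sup>2 * p) * L" using p pos by simp
    also have "\<dots> \<le> c * L" using cp c pos by (intro mult_right_mono) auto
    finally show ?thesis by simp
  qed
  have X3: "real (card X3) \<le> 4 * c * L"
  proof -
    have "real (card (Y1 \<union> Y2)) \<le> real (card Y1) + real (card Y2)"
      using card_Un_le[of Y1 Y2] by linarith
    also have "\<dots> \<le> 2 * (c\<^sup>2 * p * M)" using Y1 Y2 by simp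
    finally have Y12: "real (card (Y1 \<union> Y2)) \<le> 2 * (c\<^sup>2 * p * M)" .
    have s: "sqrt (real (card X) * real (card (Y1 \<union> Y2))) \<le> 2 * (c * r * sqrt (L * M))"
    proof (rule real_le_lsqrt)
      have "real (card X) * real (card (Y1 \<union> Y2)) \<le> L * (2 * (c\<^sup>2 * p * M))"
        using Y12 pos by (simp add: card)
      also have "\<dots> \<le> (2 * (c * r * sqrt (L * M)))\<^sup>2"
        using pos by (simp add: pr power_mult_distrib)
      finally show "real (card X) * real (card (Y1 \<union> Y2)) \<le> (2 * (c * r * sqrt (L * M)))\<^sup>2" .
    qed (use c pr pos in auto)
    have "(c * p * M) * real (card X3) \<le> (\<Sum>x\<in>X. \<Sum>y\<in>Y1 \<union> Y2. a x y)"
      unfolding X3_def using fin(1) c p pos a0 by (intro markov_card) (auto simp: sum_nonneg)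
    also have "\<dots> \<le> p * L * real (card (Y1 \<union> Y2))
        + (c * r^3 * sqrt (L * M)) * sqrt (real (card X) * real (card (Y1 \<union> Y2)))"
      using jumbled_upper[OF jX, of X "Y1 \<union> Y2"] sub by (simp add: card)
    also have "\<dots> \<le> p * L * (2 * (c\<^sup>2 * p * M)) + (c * r^3 * sqrt (L * M)) * (2 * (c * r * sqrt (L * M)))"
      using Y12 s p c pr pos by (intro add_mono mult_left_mono) auto
    also have "\<dots> = 2 * c\<^sup>2 * p\<^sup>2 * L * M + 2 * c\<^sup>2 * r^4 * (sqrt (L * M))\<^sup>2"
      by (simp add: power2_eq_square eval_nat_numeral mult_ac)
    also have "\<dots> = (c * p * M) * (4 * (c * p) * L)"
      using pos by (simp add: pr power2_eq_square eval_nat_numeral mult_ac)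
    finally have "real (card X3) \<le> 4 * (c * p) * L" using c p pos by simp
    also have "\<dots> \<le> 4 * c * L" using c p pos by (intro mult_right_mono) auto
    finally show ?thesis .
  qed
  have X4: "real (card X4) \<le> (12 * \<mu> + 160 * c\<^sup>2) / \<delta>\<^sup>2 * L"
  proof -
    have "(\<delta>\<^sup>2 * p^4 * M\<^sup>2 * N) * real (card X4) \<le> (\<Sum>x\<in>X. f x)"
      unfolding X4_def using fin(1) \<delta> p pos by (intro markov_card) (auto simp: f_def sum_nonneg)
    also note f_sum
    finally have "(p^4 * M\<^sup>2 * N) * (\<delta>\<^sup>2 * real (card X4)) \<le> (p^4 * M\<^sup>2 * N) * ((12 * \<mu> + 160 * c\<^sup>2) * L)"
      by (simp add: mult_ac)
    then have "\<delta>\<^sup>2 * real (card X4) \<le> (12 * \<mu> + 160 * c\<^sup>2) * L"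
      using p pos by (subst (asm) mult_le_cancel_left_pos) auto
    then show ?thesis using \<delta> by (simp add: field_simps)
  qed

  have good: "\<bar>\<Sum>y\<in>S. \<Sum>z\<in>T. (h y z - q)\<bar> \<le> (\<delta> + 14 * c) * p\<^sup>2 * M * N"
    if x: "x \<in> X" "x \<notin> X2" "x \<notin> X3" "x \<notin> X4" and S: "S \<subseteq> {y\<in>Y. a x y = 1}" and T: "T \<subseteq> Z" for x S T
  proof -
    define g where "g = (\<lambda>y z. h y z - q)"
    define S0 where "S0 = S \<inter> Y0"
    define S1 where "S1 = S - Y0"
    define T0 where "T0 = T \<inter> Z0"
    define T1 where "T1 = T - Z0"
    have SY: "S \<subseteq> Y" using S by auto
    have finS: "finite S" "finite T" using SY T fin by (auto intro: finite_subset)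
    have split: "(\<Sum>y\<in>S. \<Sum>z\<in>T. g y z) =
        (\<Sum>y\<in>S0. \<Sum>z\<in>T0. g y z) + (\<Sum>y\<in>S0. \<Sum>z\<in>T1. g y z) + (\<Sum>y\<in>S1. \<Sum>z\<in>T. g y z)"
    proof -
      have "(\<Sum>y\<in>S. \<Sum>z\<in>T. g y z) = (\<Sum>y\<in>S0. \<Sum>z\<in>T. g y z) + (\<Sum>y\<in>S1. \<Sum>z\<in>T. g y z)"
        unfolding S0_def S1_def by (rule sum.Int_Diff[OF finS(1)])
      moreover have "(\<Sum>z\<in>T. g y z) = (\<Sum>z\<in>T0. g y z) + (\<Sum>z\<in>T1. g y z)" for y
        unfolding T0_def T1_def by (rule sum.Int_Diff[OF finS(2)])
      ultimately show ?thesis by (simp add: sum.distrib)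
    qed
    have main: "\<bar>\<Sum>y\<in>S0. \<Sum>z\<in>T0. g y z\<bar> \<le> \<delta> * p\<^sup>2 * M * N"
    proof -
      have "(\<Sum>y\<in>S0. \<Sum>z\<in>T0. g y z)\<^sup>2 \<le> real (card Z0) * (\<Sum>y\<in>S0. \<Sum>y'\<in>S0. \<bar>K y y'\<bar>)"
        unfolding K_def g_def T0_def by (rule discrepancy_sq_le_codegree_sum[OF fin0(2)]) auto
      also have "\<dots> \<le> N * f x"
      proof (intro mult_mono card0)
        have S0: "S0 \<subseteq> nb x Y0" using S by (auto simp: S0_def nb_def)
        have fnb: "finite (nb x Y0)" using fin0 by (auto simp: nb_def)
        have "(\<Sum>y\<in>S0. \<Sum>y'\<in>S0. \<bar>K y y'\<bar>) \<le> (\<Sum>y\<in>S0. \<Sum>y'\<in>nb x Y0. \<bar>K y y'\<bar>)"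
          using S0 fnb by (intro sum_mono sum_mono2) auto
        also have "\<dots> \<le> f x"
          unfolding f_def using S0 fnb by (intro sum_mono2) (auto simp: sum_nonneg)
        finally show "(\<Sum>y\<in>S0. \<Sum>y'\<in>S0. \<bar>K y y'\<bar>) \<le> f x" .
      qed (use pos in \<open>auto simp: sum_nonneg\<close>)
      also have "\<dots> \<le> N * (\<delta>\<^sup>2 * p^4 * M\<^sup>2 * N)"
        using x pos by (intro mult_left_mono) (auto simp: X4_def)
      also have "\<dots> = (\<delta> * p\<^sup>2 * M * N)\<^sup>2"
        by (simp add: power2_eq_square power4_eq_xxxx mult_ac)
      finally have "(\<Sum>y\<in>S0. \<Sum>z\<in>T0. g y z)\<^sup>2 \<le> (\<delta> * p\<^sup>2 * M * N)\<^sup>2" .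
      then show ?thesis using \<delta> p pos by (simp add: abs_le_square_iff[symmetric])
    qed
    have cardS: "real (card S) \<le> 2 * p * M"
    proof -
      have "real (card S) \<le> real (card {y\<in>Y. a x y = 1})" using S fin by (simp add: card_mono)
      also have "\<dots> = (\<Sum>y\<in>Y. a x y)" using sum_zero_one[OF fin(2), of "a x"] a by simp
      finally show ?thesis using x by (auto simp: X2_def)
    qed
    have cardS1: "real (card S1) \<le> c * p * M"
    proof -
      have "S1 \<subseteq> {y\<in>Y1 \<union> Y2. a x y = 1}" using S by (auto simp: S1_def Y0_def)
      then have "real (card S1) \<le> real (card {y\<in>Y1 \<union> Y2. a x y = 1})" using fin0 by (simp add: card_mono)
      also have "\<dots> = (\<Sum>y\<in>Y1 \<union> Y2. a x y)" using sum_zero_one[of "Y1 \<union> Y2" "a x"] a fin0 by simp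
      finally show ?thesis using x by (auto simp: X3_def)
    qed
    have r1: "\<bar>\<Sum>y\<in>S0. \<Sum>z\<in>T1. g y z\<bar> \<le> 7 * c * p\<^sup>2 * M * N"
      unfolding g_def
    proof (rule jumbled_small_discrepancy[OF jZ h0 hb q p less_imp_le[OF c(1)] c(2) pos(2,3)])
      have "real (card S0) \<le> 2 * p * M"
        using cardS card_mono[of S S0] finS by (force simp: S0_def)
      moreover have "real (card T1) \<le> c * N"
        using Z1 card_mono[of Z1 T1] fin0 T by (force simp: T1_def Z0_def)
      ultimately have "real (card S0) * real (card T1) \<le> (2 * p * M) * (c * N)"
        using p pos by (intro mult_mono) auto
      then show "real (card S0) * real (card T1) \<le> 2 * c * p * M * N" by (simp add: mult_ac)
    qed (use SY T in \<open>auto simp: S0_def T1_def\<close>)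
    have r2: "\<bar>\<Sum>y\<in>S1. \<Sum>z\<in>T. g y z\<bar> \<le> 7 * c * p\<^sup>2 * M * N"
      unfolding g_def
    proof (rule jumbled_small_discrepancy[OF jZ h0 hb q p less_imp_le[OF c(1)] c(2) pos(2,3)])
      have "real (card T) \<le> N" using T fin by (simp add: card card_mono)
      then have "real (card S1) * real (card T) \<le> (c * p * M) * N"
        using cardS1 c p pos by (intro mult_mono) auto
      also have "\<dots> \<le> 2 * c * p * M * N" using c p pos by simp
      finally show "real (card S1) * real (card T) \<le> 2 * c * p * M * N" .
    qed (use SY T in \<open>auto simp: S1_def\<close>)
    have "\<bar>\<Sum>y\<in>S. \<Sum>z\<in>T. g y z\<bar> \<le> \<delta> * p\<^sup>2 * M * N + 7 * c * p\<^sup>2 * M * N + 7 * c * p\<^sup>2 * M * N"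
      unfolding split using main r1 r2 by linarith
    then show ?thesis unfolding g_def by (simp add: algebra_simps)
  qed
  have "{x\<in>X. \<not> (p * M / 2 \<le> (\<Sum>y\<in>Y. a x y) \<and>
      (\<forall>S T. S \<subseteq> {y\<in>Y. a x y = 1} \<longrightarrow> T \<subseteq> Z \<longrightarrow>
        \<bar>\<Sum>y\<in>S. \<Sum>z\<in>T. (h y z - q)\<bar> \<le> (\<delta> + 14 * c) * p\<^sup>2 * M * N))} \<subseteq> X1 \<union> X2 \<union> X3 \<union> X4"
    (is "?B \<subseteq> _")
  proof
    fix x assume "x \<in> ?B"
    then have "x \<in> X" and "x \<in> X1 \<or> \<not> (\<forall>S T. S \<subseteq> {y\<in>Y. a x y = 1} \<longrightarrow> T \<subseteq> Z \<longrightarrow>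
        \<bar>\<Sum>y\<in>S. \<Sum>z\<in>T. (h y z - q)\<bar> \<le> (\<delta> + 14 * c) * p\<^sup>2 * M * N)"
      unfolding X1_def by auto
    then show "x \<in> X1 \<union> X2 \<union> X3 \<union> X4" using good by blast
  qed
  then have "card ?B \<le> card (X1 \<union> X2 \<union> X3 \<union> X4)" using finX by (intro card_mono) auto
  also have "\<dots> \<le> card X1 + card X2 + card X3 + card X4"
    using card_Un_le[of "X1 \<union> X2 \<union> X3" X4] card_Un_le[of "X1 \<union> X2" X3] card_Un_le[of X1 X2] by linarith
  finally have "real (card ?B) \<le> real (card X1) + real (card X2) + real (card X3) + real (card X4)"
    by (simp flip: of_nat_add)
  also have "\<dots> \<le> 2 * c * L + c * L + 4 * c * L + (12 * \<mu> + 160 * c\<^sup>2) / \<delta>\<^sup>2 * L"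
    using X1 X2 X3 X4 by (intro add_mono)
  also have "\<dots> = (7 * c + (12 * \<mu> + 160 * c\<^sup>2) / \<delta>\<^sup>2) * L"
    by (simp only: ring_distribs)
  finally show ?thesis .
qed

section \<open>Adjacency functions, regularity and cut discrepancy\<close>

definition adj :: "'a sgraph \<Rightarrow> 'a \<Rightarrow> 'a \<Rightarrow> real" where
  "adj G u v = of_bool ({u, v} \<in> edges G)"

lemma adj_zero_one: "adj G u v = 0 \<or> adj G u v = 1"
  by (simp add: adj_def)

text \<open>Disjointness of the two sides matters: an edge then arises from exactly one ordered pair.\<close>

lemma num_edges_eq_sum_adj:
  assumes "finite U" "finite W" "U \<inter> W = {}"
  shows "real (num_edges G U W) = (\<Sum>u\<in>U. \<Sum>w\<in>W. adj G u w)"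
proof -
  let ?P = "{x\<in>U \<times> W. {fst x, snd x} \<in> edges G}"
  have "{e \<in> edges G. \<exists>u\<in>U. \<exists>w\<in>W. e = {u, w}} = (\<lambda>x. {fst x, snd x}) ` ?P"
    (is "?E = ?f ` _")
  proof (intro equalityI subsetI)
    fix e assume "e \<in> ?E"
    then obtain u w where "e = {u, w}" "u \<in> U" "w \<in> W" "e \<in> edges G" by auto
    then show "e \<in> ?f ` ?P" by (intro image_eqI[of _ _ "(u, w)"]) auto
  next
    fix e assume "e \<in> ?f ` ?P"
    then obtain u w where "e = {u, w}" "u \<in> U" "w \<in> W" "e \<in> edges G" by auto
    then show "e \<in> ?E" by blast
  qed
  moreover have "inj_on (\<lambda>x. {fst x, snd x}) ?P"
    using assms(3) by (auto simp: inj_on_def doubleton_eq_iff)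
  ultimately have "num_edges G U W = card ?P" by (simp add: num_edges_def card_image)
  also have "real (card ?P) = (\<Sum>x\<in>U \<times> W. of_bool ({fst x, snd x} \<in> edges G))"
    using assms by (simp add: sum_of_bool_eq Int_def)
  also have "\<dots> = (\<Sum>u\<in>U. \<Sum>w\<in>W. adj G u w)"
    by (simp add: sum.cartesian_product adj_def case_prod_unfold)
  finally show ?thesis .
qed

lemma bijumbled_imp_jumbled:
  assumes b: "bijumbled p \<gamma> G U V" and le: "\<gamma> \<le> \<gamma>'" and fin: "finite U" "finite V"
  shows "jumbled p \<gamma>' (adj G) U V"
  unfolding jumbled_def
proof (intro allI impI)
  fix S T assume ST: "S \<subseteq> U" "T \<subseteq> V"
  have "U \<inter> V = {}" using b by (simp add: bijumbled_def vertex_pair_def)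
  then have "real (num_edges G S T) = (\<Sum>u\<in>S. \<Sum>v\<in>T. adj G u v)"
    using ST fin by (intro num_edges_eq_sum_adj) (auto intro: finite_subset)
  then have "(\<Sum>u\<in>S. \<Sum>v\<in>T. (adj G u v - p)) = real (num_edges G S T) - p * real (card S) * real (card T)"
    by (simp add: sum_subtractf)
  then have "\<bar>\<Sum>u\<in>S. \<Sum>v\<in>T. (adj G u v - p)\<bar> \<le> \<gamma> * sqrt (real (card S) * real (card T))"
    using b ST unfolding bijumbled_def by presburger
  also have "\<dots> \<le> \<gamma>' * sqrt (real (card S) * real (card T))"
    using le by (intro mult_right_mono) auto
  finally show "\<bar>\<Sum>u\<in>S. \<Sum>v\<in>T. (adj G u v - p)\<bar> \<le> \<gamma>' * sqrt (real (card S) * real (card T))" .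
qed

lemma p_density_diff:
  assumes "p > 0" "card S > 0" "card T > 0" "finite S" "finite T" "S \<inter> T = {}"
  shows "p_density p G S T - q / p
    = (\<Sum>y\<in>S. \<Sum>z\<in>T. (adj G y z - q)) / (p * (real (card S) * real (card T)))"
proof -
  have "(\<Sum>y\<in>S. \<Sum>z\<in>T. (adj G y z - q)) = real (num_edges G S T) - q * (real (card S) * real (card T))"
    using num_edges_eq_sum_adj[OF assms(4-6)] by (simp add: sum_subtractf)
  moreover have "p_density p G S T - q / p
      = (real (num_edges G S T) - q * (real (card S) * real (card T))) / (p * (real (card S) * real (card T)))"
    using assms(1-3) unfolding p_density_def diff_divide_distrib
    by (simp add: mult.assoc del: card_gt_0_iff card_0_eq card_eq_0_iff)
  ultimately show ?thesis by simp
qed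

text \<open>For large \<open>S\<close> and \<open>T\<close> the cut bound is regularity. Otherwise \<open>card S * card T\<close> is at most the \<open>\<epsilon>\<close>
  fraction of \<open>card Y * card Z\<close>, and the bound holds because jumbledness of the ambient graph limits
  the number of edges.\<close>

lemma sparse_regular_imp_small_cut_discrepancy:
  assumes reg: "sparse_regular \<epsilon> p G Y Z" and fin: "finite Y" "finite Z"
    and \<epsilon>: "\<epsilon> > 0" and p: "0 < p" "p \<le> 1" and c: "0 \<le> c" "c \<le> 1"
    and j: "jumbled p (c * p\<^sup>2 * sqrt (real (card Y) * real (card Z))) b Y Z"
    and sub: "\<And>y z. adj G y z \<le> b y z"
    and q: "q = p * p_density p G Y Z"
  shows "0 \<le> q" "q \<le> 2 * p"
    and "\<And>S T. S \<subseteq> Y \<Longrightarrow> T \<subseteq> Z \<Longrightarrow> \<bar>\<Sum>y\<in>S. \<Sum>z\<in>T. (adj G y z - q)\<bar>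
      \<le> (3 * \<epsilon> + c) * p * real (card Y) * real (card Z)"
proof -
  define M where "M = real (card Y)"
  define N where "N = real (card Z)"
  have disj: "Y \<inter> Z = {}" and MN: "M > 0" "N > 0"
    using reg fin by (auto simp: sparse_regular_def vertex_pair_def M_def N_def card_gt_0_iff)
  have e_le: "(\<Sum>y\<in>S. \<Sum>z\<in>T. adj G y z)
      \<le> p * (real (card S) * real (card T)) + c * p\<^sup>2 * sqrt (M * N) * sqrt (real (card S) * real (card T))"
    if "S \<subseteq> Y" "T \<subseteq> Z" for S T
  proof -
    have "(\<Sum>y\<in>S. \<Sum>z\<in>T. adj G y z) \<le> (\<Sum>y\<in>S. \<Sum>z\<in>T. b y z)" by (intro sum_mono sub)
    then show ?thesis using jumbled_upper[OF j that] by (simp add: M_def N_def)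
  qed
  have adj0: "0 \<le> adj G y z" for y z by (simp add: adj_def)
  have q_eq: "q = (\<Sum>y\<in>Y. \<Sum>z\<in>Z. adj G y z) / (M * N)"
    using p num_edges_eq_sum_adj[OF fin disj] unfolding q p_density_def M_def N_def by simp
  show q0: "0 \<le> q" unfolding q_eq using MN adj0 by (simp add: sum_nonneg)
  have pp: "c * p\<^sup>2 \<le> c * p" using c p by (intro mult_left_mono) (auto simp: power2_eq_square mult_left_le)
  show q2: "q \<le> 2 * p"
  proof -
    have "(\<Sum>y\<in>Y. \<Sum>z\<in>Z. adj G y z) \<le> p * (M * N) + c * p\<^sup>2 * (M * N)"
      using e_le[of Y Z] MN by (simp add: M_def N_def mult.assoc)
    also have "c * p\<^sup>2 * (M * N) \<le> p * (M * N)"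
    proof (rule mult_right_mono)
      have "c * p \<le> p" using c p by simp
      with pp show "c * p\<^sup>2 \<le> p" by linarith
    qed (use MN in auto)
    finally show ?thesis unfolding q_eq using MN by (simp add: field_simps)
  qed
  fix S T assume ST: "S \<subseteq> Y" "T \<subseteq> Z"
  define s where "s = real (card S)"
  define t where "t = real (card T)"
  have finST: "finite S" "finite T" using ST fin by (auto intro: finite_subset)
  have st: "0 \<le> s" "s \<le> M" "0 \<le> t" "t \<le> N"
    using ST fin by (auto simp: s_def t_def M_def N_def card_mono)
  have stMN: "s * t \<le> M * N" using st MN by (intro mult_mono) auto
  have sum_eq: "(\<Sum>y\<in>S. \<Sum>z\<in>T. (adj G y z - q)) = (\<Sum>y\<in>S. \<Sum>z\<in>T. adj G y z) - q * (s * t)"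
    by (simp add: sum_subtractf s_def t_def)
  have "\<bar>\<Sum>y\<in>S. \<Sum>z\<in>T. (adj G y z - q)\<bar> \<le> (3 * \<epsilon> + c) * (p * (M * N))"
  proof (cases "s \<ge> \<epsilon> * M \<and> t \<ge> \<epsilon> * N")
    case True
    have "0 < \<epsilon> * M" "0 < \<epsilon> * N" using \<epsilon> MN by auto
    then have pos: "s > 0" "t > 0" using True by linarith+
    have "\<bar>p_density p G S T - q / p\<bar> \<le> \<epsilon>"
      using reg ST True p unfolding sparse_regular_def q s_def t_def M_def N_def by simp
    moreover have "S \<inter> T = {}" using ST disj by blast
    ultimately have "\<bar>(\<Sum>y\<in>S. \<Sum>z\<in>T. (adj G y z - q)) / (p * (s * t))\<bar> \<le> \<epsilon>"
      using p_density_diff[OF p(1), of S T G q] pos finST by (simp add: s_def t_def)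
    then have "\<bar>\<Sum>y\<in>S. \<Sum>z\<in>T. (adj G y z - q)\<bar> \<le> \<epsilon> * (p * (s * t))"
      using p pos by (simp add: abs_divide pos_divide_le_eq)
    also have "\<dots> \<le> (3 * \<epsilon> + c) * (p * (M * N))"
      using stMN \<epsilon> c p st MN by (intro mult_mono) auto
    finally show ?thesis .
  next
    case False
    have st_small: "s * t \<le> \<epsilon> * (M * N)"
    proof (cases "s \<le> \<epsilon> * M")
      case True
      then have "s * t \<le> (\<epsilon> * M) * N" using st \<epsilon> MN by (intro mult_mono) auto
      then show ?thesis by simp
    next
      case F: False
      then have "s * t \<le> M * (\<epsilon> * N)" using False st \<epsilon> MN by (intro mult_mono) auto
      then show ?thesis by (simp add: mult_ac)
    qed
    have "(\<Sum>y\<in>S. \<Sum>z\<in>T. adj G y z) \<le> p * (s * t) + c * p\<^sup>2 * sqrt (M * N) * sqrt (s * t)"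
      using e_le[OF ST] by (simp add: s_def t_def)
    also have "\<dots> \<le> p * (\<epsilon> * (M * N)) + c * p\<^sup>2 * sqrt (M * N) * sqrt (M * N)"
      using st_small stMN p c MN by (intro add_mono mult_left_mono real_sqrt_le_mono) auto
    also have "\<dots> = p * (\<epsilon> * (M * N)) + c * p\<^sup>2 * (M * N)" using MN by (simp add: mult.assoc)
    also have "\<dots> \<le> p * (\<epsilon> * (M * N)) + c * p * (M * N)"
      using pp MN by (intro add_left_mono mult_right_mono) auto
    finally have up: "(\<Sum>y\<in>S. \<Sum>z\<in>T. adj G y z) \<le> (\<epsilon> + c) * (p * (M * N))" by (simp add: algebra_simps)
    have "q * (s * t) \<le> (2 * p) * (\<epsilon> * (M * N))"
      using p st by (intro mult_mono[OF q2 st_small]) auto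
    then have qs: "q * (s * t) \<le> 2 * \<epsilon> * (p * (M * N))" by (simp add: mult_ac)
    have W: "0 \<le> p * (M * N)" using p MN by simp
    have "(\<epsilon> + c) * (p * (M * N)) \<le> (3 * \<epsilon> + c) * (p * (M * N))"
      "2 * \<epsilon> * (p * (M * N)) \<le> (3 * \<epsilon> + c) * (p * (M * N))"
      using \<epsilon> c by (intro mult_right_mono W; linarith)+
    with up qs have "(\<Sum>y\<in>S. \<Sum>z\<in>T. adj G y z) \<le> (3 * \<epsilon> + c) * (p * (M * N))"
      "q * (s * t) \<le> (3 * \<epsilon> + c) * (p * (M * N))"
      by (auto intro: order_trans)
    moreover have "0 \<le> (\<Sum>y\<in>S. \<Sum>z\<in>T. adj G y z)" "0 \<le> q * (s * t)"
      using adj0 q0 st by (auto simp: sum_nonneg)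
    ultimately show ?thesis unfolding sum_eq by (intro abs_leI) linarith+
  qed
  then show "\<bar>\<Sum>y\<in>S. \<Sum>z\<in>T. (adj G y z - q)\<bar> \<le> (3 * \<epsilon> + c) * p * real (card Y) * real (card Z)"
    by (simp add: M_def N_def mult.assoc)
qed

text \<open>Closeness to a common value \<open>D\<close>, which need not be the density of \<open>(A, Z)\<close>, is the form in which
  regularity is inherited from \<open>(Y, Z)\<close>.\<close>

lemma sparse_regular_if_densities_close:
  assumes "vertex_pair G A Z" "A \<noteq> {}" "Z \<noteq> {}" and e: "0 < e" "e \<le> 1"
    and close: "\<And>S T. S \<subseteq> A \<Longrightarrow> T \<subseteq> Z \<Longrightarrow> real (card S) \<ge> e * real (card A)
      \<Longrightarrow> real (card T) \<ge> e * real (card Z) \<Longrightarrow> \<bar>p_density p G S T - D\<bar> \<le> e / 4"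
    and D: "D \<ge> d - e / 4"
  shows "sparse_regular_dense e d p G A Z"
proof -
  have AZ: "\<bar>p_density p G A Z - D\<bar> \<le> e / 4"
    using e by (intro close) (auto simp: mult_left_le_one_le)
  have "\<bar>p_density p G S T - p_density p G A Z\<bar> \<le> e"
    if "S \<subseteq> A" "T \<subseteq> Z" "real (card S) \<ge> e * real (card A)" "real (card T) \<ge> e * real (card Z)" for S T
    using close[OF that] AZ e by linarith
  then show ?thesis
    unfolding sparse_regular_dense_def sparse_regular_def using assms(1-3) AZ D e by auto
qed

lemma sparse_regular_dense_mono:
  assumes "sparse_regular_dense e d p G A Z" "e \<le> e'"
  shows "sparse_regular_dense e' d p G A Z"
proof -
  have size: "e * real n \<le> x" if "e' * real n \<le> x" for n x
    using that mult_right_mono[OF assms(2), of "real n"] by simp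
  have "\<bar>p_density p G S T - p_density p G A Z\<bar> \<le> e'"
    if "S \<subseteq> A" "T \<subseteq> Z" "e' * real (card A) \<le> real (card S)" "e' * real (card Z) \<le> real (card T)" for S T
  proof -
    have "\<bar>p_density p G S T - p_density p G A Z\<bar> \<le> e"
      using assms(1) that size unfolding sparse_regular_dense_def sparse_regular_def by blast
    then show ?thesis using assms(2) by linarith
  qed
  moreover have "d - e' \<le> p_density p G A Z"
    using assms unfolding sparse_regular_dense_def by linarith
  ultimately show ?thesis
    using assms(1) unfolding sparse_regular_dense_def sparse_regular_def by blast
qed

text \<open>The sets tested have \<open>card S * card T \<ge> e\<^sup>2 p M (card Z) / 2\<close>, so the discrepancy \<open>e\<^sup>3/8\<close> becomes a
  deviation \<open>e/4\<close> of \<open>p\<close>-densities.\<close>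

lemma sparse_regular_if_small_discrepancy:
  assumes vp: "vertex_pair G A Z" and fin: "finite A" "finite Z" and Z: "Z \<noteq> {}"
    and p: "p > 0" and M: "M > 0" and A: "real (card A) \<ge> p * M / 2" and e: "0 < e" "e \<le> 1"
    and disc: "\<And>S T. S \<subseteq> A \<Longrightarrow> T \<subseteq> Z \<Longrightarrow> \<bar>\<Sum>y\<in>S. \<Sum>z\<in>T. (adj G y z - q)\<bar>
      \<le> e^3 / 8 * p\<^sup>2 * M * real (card Z)"
    and d: "q / p \<ge> d - e / 4"
  shows "sparse_regular_dense e d p G A Z"
proof (rule sparse_regular_if_densities_close[OF vp _ Z e _ d])
  have "p * M / 2 > 0" using p M by simp
  then show "A \<noteq> {}" using A by auto
  fix S T
  assume S: "S \<subseteq> A" and T: "T \<subseteq> Z"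
    and cS: "real (card S) \<ge> e * real (card A)" and cT: "real (card T) \<ge> e * real (card Z)"
  define s where "s = real (card S)"
  define t where "t = real (card T)"
  define N where "N = real (card Z)"
  have N: "N > 0" using fin Z by (simp add: N_def card_gt_0_iff)
  have "e * (p * M / 2) \<le> e * real (card A)" using A e by (intro mult_left_mono) auto
  then have s: "e * (p * M / 2) \<le> s" using cS by (simp add: s_def)
  have t: "e * N \<le> t" using cT by (simp add: t_def N_def)
  have pos: "0 < e * (p * M / 2)" "0 < e * N" using e p M N by auto
  then have st0: "s > 0" "t > 0" using s t by linarith+
  have "(e * (p * M / 2)) * (e * N) \<le> s * t" using s t pos st0 by (intro mult_mono) auto
  then have "e / 4 * p * ((e * (p * M / 2)) * (e * N)) \<le> e / 4 * p * (s * t)"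
    using e p by (intro mult_left_mono) auto
  moreover have "\<bar>\<Sum>y\<in>S. \<Sum>z\<in>T. (adj G y z - q)\<bar> \<le> e / 4 * p * ((e * (p * M / 2)) * (e * N))"
    using disc[OF S T] by (simp add: N_def power2_eq_square power3_eq_cube mult_ac)
  ultimately have "\<bar>\<Sum>y\<in>S. \<Sum>z\<in>T. (adj G y z - q)\<bar> \<le> e / 4 * (p * (s * t))"
    unfolding mult.assoc[of "e / 4" p] by linarith
  then have "\<bar>(\<Sum>y\<in>S. \<Sum>z\<in>T. (adj G y z - q)) / (p * (s * t))\<bar> \<le> e / 4"
    using p st0 by (simp add: abs_divide pos_divide_le_eq)
  moreover have "finite S" "finite T" "S \<inter> T = {}"
    using S T fin vp by (auto intro: finite_subset simp: vertex_pair_def)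
  ultimately show "\<bar>p_density p G S T - q / p\<bar> \<le> e / 4"
    using p_density_diff[OF p, of S T G q] st0 by (simp add: s_def t_def)
qed

text \<open>A quarter of \<open>Y\<close> is still large on the scale of \<open>\<epsilon>\<close>, so regularity applies to its subsets.\<close>

lemma sparse_regular_dense_slice:
  assumes reg: "sparse_regular_dense \<epsilon> d p G Y Z" and fin: "finite Y" "finite Z"
    and A: "A \<subseteq> Y" "real (card A) \<ge> real (card Y) / 4" and e: "0 < e" "e \<le> 1" "\<epsilon> \<le> e / 4"
  shows "sparse_regular_dense e d p G A Z"
proof (rule sparse_regular_if_densities_close[OF _ _ _ e(1,2), where D = "p_density p G Y Z"])
  have Y: "Y \<noteq> {}" using reg by (simp add: sparse_regular_dense_def sparse_regular_def)
  then have "real (card Y) > 0" using fin by (simp add: card_gt_0_iff)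
  then show "A \<noteq> {}" using A(2) by auto
  show "vertex_pair G A Z" "Z \<noteq> {}" "p_density p G Y Z \<ge> d - e / 4"
    using reg A e by (auto simp: sparse_regular_dense_def sparse_regular_def vertex_pair_def)
  fix S T
  assume S: "S \<subseteq> A" and T: "T \<subseteq> Z"
    and cS: "real (card S) \<ge> e * real (card A)" and cT: "real (card T) \<ge> e * real (card Z)"
  have "\<epsilon> * real (card Y) \<le> e / 4 * real (card Y)" using e by (intro mult_right_mono) auto
  also have "\<dots> \<le> e * real (card A)" using mult_left_mono[OF A(2), of e] e by simp
  finally have "\<epsilon> * real (card Y) \<le> real (card S)" using cS by linarith
  moreover have "\<epsilon> * real (card Z) \<le> real (card T)"
    using mult_right_mono[of \<epsilon> e "real (card Z)"] e cT by simp
  moreover have "S \<subseteq> Y" using S A by blast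
  ultimately have "\<bar>p_density p G S T - p_density p G Y Z\<bar> \<le> \<epsilon>"
    using reg T unfolding sparse_regular_dense_def sparse_regular_def by blast
  then show "\<bar>p_density p G S T - p_density p G Y Z\<bar> \<le> e / 4" using e by linarith
qed

section \<open>Inheritance of regularity\<close>

theorem lemma3:
  fixes \<epsilon>' d :: real
  assumes "\<epsilon>' > 0" and "d > 0"
  shows "\<exists>\<epsilon>>0. \<exists>c>0. \<forall>p::real. 0 < p \<longrightarrow> p < 1 \<longrightarrow>
    (\<forall>(\<Gamma> :: 'a sgraph) (G :: 'a sgraph) X Y Z.
       simple_graph \<Gamma> \<longrightarrow> simple_graph G \<longrightarrow> is_subgraph G \<Gamma> \<longrightarrow>
       X \<subseteq> verts \<Gamma> \<longrightarrow> Y \<subseteq> verts \<Gamma> \<longrightarrow> Z \<subseteq> verts \<Gamma> \<longrightarrow>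
       X \<inter> Y = {} \<longrightarrow> X \<inter> Z = {} \<longrightarrow> Y \<inter> Z = {} \<longrightarrow>
       bijumbled p (c * p powr (3/2) * sqrt (real (card X) * real (card Y))) \<Gamma> X Y \<longrightarrow>
       bijumbled p (c * p ^ 2 * (log 2 (1 / p)) powr (-1/2) * sqrt (real (card Y) * real (card Z)))
         \<Gamma> Y Z \<longrightarrow>
       sparse_regular_dense \<epsilon> d p G Y Z \<longrightarrow>
       real (card {x \<in> X. \<not> sparse_regular_dense \<epsilon>' d p G (neighbourhood \<Gamma> x \<inter> Y) Z})
         \<le> \<epsilon>' * real (card X))"
proof -
  \<comment> \<open>Half of the discrepancy \<open>e\<^sup>3/8\<close> is \<open>\<delta>\<close>, the other half covers \<open>14 c\<close>; \<open>\<mu>\<close> makes \<open>12 \<mu> / \<delta>\<^sup>2\<close> at most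
    \<open>e/8\<close>, and \<open>c\<close>, which also serves as \<open>\<epsilon>\<close>, satisfies \<open>16 (3 \<epsilon> + c) + 25 c \<le> \<mu>\<^sup>2\<close>.\<close>
  define e where "e = min \<epsilon>' 1"
  define \<delta> where "\<delta> = e^3 / 16"
  define \<mu> where "\<mu> = e * \<delta>\<^sup>2 / 100"
  define c where "c = \<mu>\<^sup>2 / 100"
  have e: "0 < e" "e \<le> 1" "e \<le> \<epsilon>'" using assms by (auto simp: e_def)
  have \<delta>: "0 < \<delta>" using e by (simp add: \<delta>_def)
  have e3: "e^3 \<le> e" using e power_decreasing[of 1 3 e] by simp
  have \<delta>e: "\<delta> \<le> e / 16" "\<delta> \<le> 1" using e3 e by (auto simp: \<delta>_def)
  have \<delta>2: "\<delta>\<^sup>2 \<le> \<delta>" using \<delta> \<delta>e by (simp add: power2_eq_square mult_left_le)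
  have \<mu>0: "0 < \<mu>" using e \<delta> by (simp add: \<mu>_def)
  have "e * \<delta>\<^sup>2 \<le> 1 * \<delta>\<^sup>2" using e by (intro mult_right_mono) auto
  then have \<mu>\<delta>: "\<mu> \<le> \<delta> / 100" using \<delta>2 by (simp add: \<mu>_def)
  have \<mu>1: "\<mu> \<le> 1" using \<mu>\<delta> \<delta>e by simp
  have \<mu>2: "\<mu>\<^sup>2 \<le> \<mu>" using \<mu>0 \<mu>1 by (simp add: power2_eq_square mult_left_le)
  have c0: "0 < c" using \<mu>0 by (simp add: c_def)
  have c\<mu>: "c \<le> \<mu> / 100" using \<mu>2 by (simp add: c_def)
  have c12: "c \<le> 1/2" and c1: "c \<le> 1" using c\<mu> \<mu>1 by simp_all
  have c_small: "14 * c \<le> \<delta>" "c \<le> e / 100" using c\<mu> \<mu>\<delta> \<delta>e \<delta> by auto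
  have const: "7 * c + (12 * \<mu> + 160 * c\<^sup>2) / \<delta>\<^sup>2 \<le> e"
  proof -
    have "c\<^sup>2 \<le> c * (1/2)" unfolding power2_eq_square using c0 c12 by (intro mult_left_mono) auto
    then have "12 * \<mu> + 160 * c\<^sup>2 \<le> 13 * \<mu>" using c\<mu> \<mu>0 by linarith
    then have "(12 * \<mu> + 160 * c\<^sup>2) / \<delta>\<^sup>2 \<le> 13 * \<mu> / \<delta>\<^sup>2" by (intro divide_right_mono) auto
    also have "\<dots> = 13 * e / 100" using \<delta> by (simp add: \<mu>_def)
    finally show ?thesis using c_small e by linarith
  qed
  show ?thesis
  proof (intro exI[of _ c] conjI c0 allI impI)
    fix p :: real and \<Gamma> G :: "'a sgraph" and X Y Z :: "'a set"
    assume p: "0 < p" "p < 1" and \<Gamma>: "simple_graph \<Gamma>" and sub: "is_subgraph G \<Gamma>"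
      and X: "X \<subseteq> verts \<Gamma>" and Y: "Y \<subseteq> verts \<Gamma>" and Z: "Z \<subseteq> verts \<Gamma>" and YZ: "Y \<inter> Z = {}"
      and bX: "bijumbled p (c * p powr (3/2) * sqrt (real (card X) * real (card Y))) \<Gamma> X Y"
      and bZ: "bijumbled p (c * p ^ 2 * (log 2 (1 / p)) powr (-1/2) * sqrt (real (card Y) * real (card Z))) \<Gamma> Y Z"
      and reg: "sparse_regular_dense c d p G Y Z"
    let ?bad = "{x \<in> X. \<not> sparse_regular_dense \<epsilon>' d p G (neighbourhood \<Gamma> x \<inter> Y) Z}"
    have fin: "finite X" "finite Y" "finite Z"
      using X Y Z \<Gamma> by (auto simp: simple_graph_def intro: finite_subset)
    have ne: "Y \<noteq> {}" "Z \<noteq> {}" and vp: "vertex_pair G Y Z"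
      using reg by (auto simp: sparse_regular_dense_def sparse_regular_def)
    have pos: "card Y > 0" "card Z > 0" using ne fin by (auto simp: card_gt_0_iff)
    define r where "r = sqrt p"
    have pr: "p = r\<^sup>2" "0 < r" "r \<le> 1" using p by (auto simp: r_def)
    have "p powr (3/2) = r^3"
    proof -
      have "p powr (3/2) = (p powr (1/2)) powr 3" by (simp add: powr_powr)
      also have "p powr (1/2) = r" using p by (simp add: powr_half_sqrt r_def)
      finally show ?thesis using pr(2) by simp
    qed
    then have jX: "jumbled p (c * r^3 * sqrt (real (card X) * real (card Y))) (adj \<Gamma>) X Y"
      using bijumbled_imp_jumbled[OF bX order_refl fin(1,2)] by simp
    have nb: "neighbourhood \<Gamma> x \<inter> Y = {y\<in>Y. adj \<Gamma> x y = 1}" for x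
      by (auto simp: neighbourhood_def adj_def)
    have deg: "(\<Sum>y\<in>Y. adj \<Gamma> x y) = real (card (neighbourhood \<Gamma> x \<inter> Y))" for x
      unfolding nb by (rule sum_zero_one[OF fin(2) adj_zero_one])
    have vpn: "vertex_pair G (neighbourhood \<Gamma> x \<inter> Y) Z" for x
      using vp by (auto simp: vertex_pair_def)
    have "real (card ?bad) \<le> e * real (card X)"
    proof (cases "X = {}")
      case False
      then have posX: "card X > 0" using fin by (simp add: card_gt_0_iff)
      show ?thesis
      proof (cases "p \<le> 1/2")
        case True
        have "log 2 2 \<le> log 2 (1 / p)" using True p by (subst log_le_cancel_iff) (auto simp: field_simps)
        then have "1 \<le> log 2 (1 / p)" by simp
        then have "(log 2 (1 / p)) powr (-1/2) \<le> (log 2 (1 / p)) powr 0" by (intro powr_mono) auto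
        also have "\<dots> = 1" using \<open>1 \<le> log 2 (1 / p)\<close> by simp
        finally have "(log 2 (1 / p)) powr (-1/2) \<le> 1" .
        then have "c * p^2 * (log 2 (1 / p)) powr (-1/2) * sqrt (real (card Y) * real (card Z))
            \<le> c * p^2 * 1 * sqrt (real (card Y) * real (card Z))"
          using c0 by (intro mult_right_mono mult_left_mono) auto
        then have jZ: "jumbled p (c * p\<^sup>2 * sqrt (real (card Y) * real (card Z))) (adj \<Gamma>) Y Z"
          using bijumbled_imp_jumbled[OF bZ _ fin(2,3)] by simp
        have GH: "adj G y z \<le> adj \<Gamma> y z" for y z
          using sub by (auto simp: adj_def is_subgraph_def)
        define q where "q = p * p_density p G Y Z"
        have reg': "sparse_regular c p G Y Z" using reg by (simp add: sparse_regular_dense_def)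
        note cut = sparse_regular_imp_small_cut_discrepancy[OF reg' fin(2,3) c0 p(1) less_imp_le[OF p(2)]
            less_imp_le[OF c0] c1 jZ GH q_def]
        let ?good = "\<lambda>x. p * real (card Y) / 2 \<le> (\<Sum>y\<in>Y. adj \<Gamma> x y) \<and>
          (\<forall>S T. S \<subseteq> {y\<in>Y. adj \<Gamma> x y = 1} \<longrightarrow> T \<subseteq> Z \<longrightarrow>
            \<bar>\<Sum>y\<in>S. \<Sum>z\<in>T. (adj G y z - q)\<bar> \<le> (\<delta> + 14 * c) * p\<^sup>2 * real (card Y) * real (card Z))"
        have most: "real (card {x\<in>X. \<not> ?good x}) \<le> (7 * c + (12 * \<mu> + 160 * c\<^sup>2) / \<delta>\<^sup>2) * real (card X)"
        proof (rule most_neighbourhoods_have_small_discrepancy[OF fin refl refl refl _ _ _ pr _ _ c0 c12 \<mu>0 \<mu>1 _ \<delta>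
              adj_zero_one adj_zero_one adj_zero_one GH jX jZ])
          show "16 * (3 * c + c) + 25 * c \<le> \<mu>\<^sup>2" by (simp add: c_def)
          show "0 \<le> q" "q \<le> 2 * p" by (fact cut(1), fact cut(2))
          show "\<bar>\<Sum>y\<in>S. \<Sum>z\<in>T. (adj G y z - q)\<bar>
              \<le> (3 * c + c) * p * real (card Y) * real (card Z)" if "S \<subseteq> Y" "T \<subseteq> Z" for S T
            using that by (rule cut(3))
        qed (use posX pos in simp_all)
        have dens: "q / p \<ge> d - e / 4"
          using reg p c_small e by (simp add: q_def sparse_regular_dense_def)
        have "sparse_regular_dense \<epsilon>' d p G (neighbourhood \<Gamma> x \<inter> Y) Z" if g: "?good x" for x
        proof (rule sparse_regular_dense_mono[OF _ e(3)],
            rule sparse_regular_if_small_discrepancy[OF vpn _ fin(3) ne(2) p(1) _ _ e(1,2) _ dens])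
          show "real (card (neighbourhood \<Gamma> x \<inter> Y)) \<ge> p * real (card Y) / 2" using g deg by simp
          fix S T assume "S \<subseteq> neighbourhood \<Gamma> x \<inter> Y" "T \<subseteq> Z"
          then have "\<bar>\<Sum>y\<in>S. \<Sum>z\<in>T. (adj G y z - q)\<bar> \<le> (\<delta> + 14 * c) * (p\<^sup>2 * real (card Y) * real (card Z))"
            using g unfolding nb by (simp add: mult.assoc)
          also have "\<dots> \<le> e^3 / 8 * (p\<^sup>2 * real (card Y) * real (card Z))"
            using c_small by (intro mult_right_mono) (auto simp: \<delta>_def)
          finally show "\<bar>\<Sum>y\<in>S. \<Sum>z\<in>T. (adj G y z - q)\<bar> \<le> e^3 / 8 * p\<^sup>2 * real (card Y) * real (card Z)"
            by (simp add: mult.assoc)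
        qed (use fin pos in auto)
        then have "?bad \<subseteq> {x\<in>X. \<not> ?good x}" by blast
        then have "card ?bad \<le> card {x\<in>X. \<not> ?good x}" using fin(1) by (intro card_mono finite_Collect_conjI disjI1) simp_all
        then have "real (card ?bad) \<le> (7 * c + (12 * \<mu> + 160 * c\<^sup>2) / \<delta>\<^sup>2) * real (card X)"
          using most by linarith
        also have "\<dots> \<le> e * real (card X)" using const by (intro mult_right_mono) auto
        finally show ?thesis .
      next
        case False
        let ?low = "{x\<in>X. (\<Sum>y\<in>Y. adj \<Gamma> x y) < p * real (card Y) / 2}"
        have "sparse_regular_dense \<epsilon>' d p G (neighbourhood \<Gamma> x \<inter> Y) Z" if g: "x \<in> X" "x \<notin> ?low" for x
        proof (rule sparse_regular_dense_mono[OF _ e(3)], rule sparse_regular_dense_slice[OF reg fin(2,3) _ _ e(1,2)])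
          have "1/2 * real (card Y) \<le> p * real (card Y)" using False by (intro mult_right_mono) auto
          then show "real (card (neighbourhood \<Gamma> x \<inter> Y)) \<ge> real (card Y) / 4"
            using g deg[of x] by simp
        qed (use c_small e in auto)
        then have "?bad \<subseteq> ?low" by blast
        then have "card ?bad \<le> card ?low" using fin(1) by (intro card_mono finite_Collect_conjI disjI1) simp_all
        then have "real (card ?bad) \<le> real (card ?low)" by simp
        also have "real (card ?low) \<le> 2 * c * real (card X)"
          by (rule jumbled_few_low_degrees[OF jX fin(1) \<open>X \<noteq> {}\<close> pos(1) pr less_imp_le[OF c0] c12])
        also have "\<dots> \<le> e * real (card X)" using c_small e by (intro mult_right_mono) auto
        finally show ?thesis .
      qed
    qed simp
    also have "\<dots> \<le> \<epsilon>' * real (card X)" using e by (intro mult_right_mono) auto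
    finally show "real (card ?bad) \<le> \<epsilon>' * real (card X)" .
  qed
qed

end
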